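(* Let $(H,\mathcal V)$ be a controllable LQ optimal control problem on a symplectic vector space $(\Sigma,\omega)$ of dimension $2n$. Suppose that in some symplectic (Darboux) coordinates $(p_1,\dots,p_n,x_1,\dots,x_n)$ on $\Sigma$ (i.e. $\omega=\sum_i dp_i\wedge dx_i$) the Hamiltonian can be written as $$H(p,x)=\frac12\sum_{j=1}^n\omega_j(p_j^2+x_j^2),$$ with $\omega_1,\dots,\omega_n$ nonzero real numbers. Then, for every integer $N\ge 1$, if $$T\ge\frac{(N+3n-1)\pi}{\sum_{j=1}^n\omega_j},$$ there are at least $N$ conjugate times, counted with multiplicity, in the interval $(0,T]$. In particular, the first conjugate time $\bar t=\inf\{t>0: J(t)\cap\mathcal V\ne 0\}$ satisfies $$\bar t\le\frac{3n\pi}{\sum_{j=1}^n\omega_j}.$$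
   Context: An LQ optimal control problem on a symplectic vector space $(\Sigma,\omega)$, $\dim\Sigma=2n$, is a pair $(H,\mathcal V)$ where $H:\Sigma\to\mathbb{R}$ is a quadratic form and $\mathcal V\subset\Sigma$ is a Lagrangian subspace with $H|_{\mathcal V}\ge 0$. The subspace $\mathcal V$ need not be a coordinate subspace in the coordinates appearing in the claim. The Hamiltonian vector field $\vec H$ is the linear map defined by $dH(\cdot)=\omega(\cdot,\vec H)$, and its flow is $P_t=e^{t\vec H}$. The Jacobi curve is $J(t)=e^{-t\vec H}\mathcal V$. A number $t\ne0$ is a conjugate time if $J(t)\cap\mathcal V\neq 0$, with multiplicity $\dim(J(t)\cap\mathcal V)$. Controllability: choose Darboux coordinates $(p,x)\in\mathbb{R}^{2n}$ with $\omega=\sum_i dp_i\wedge dx_i$ and $\mathcal V=\{(p,0):p\in\mathbb{R}^n\}$. Then $H(p,x)=\frac12(p^* B B^* p+2p^*Ax+x^*Qx)$ for some real matrices $A$, $B$, $Q=Q^*$, and $\vec H=\begin{pmatrix} -A^* & -Q \\ B B^* & A \end{pmatrix}$. The problem is controllable if there is $m>0$ with $\operatorname{rank}(B,AB,\dots,A^{m-1}B)=n$. *)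

theory Defs
  imports "HOL-Analysis.Analysis" "HOL-Library.Extended_Nat"
begin

text \<open>A real vector space of finite positive dimension is modelled by a type of class
  \<open>euclidean_space\<close>.  The inner product of that class plays no role below, except that it fixes the
  (unique) vector space topology needed for derivatives and for the exponential series.\<close>

definition symplectic_form :: "('a::euclidean_space \<Rightarrow> 'a \<Rightarrow> real) \<Rightarrow> bool" where
  "symplectic_form \<sigma> \<longleftrightarrow>
     bilinear \<sigma> \<and> (\<forall>v. \<sigma> v v = 0) \<and> (\<forall>v. (\<forall>w. \<sigma> v w = 0) \<longrightarrow> v = 0)"

definition lagrangian :: "('a::euclidean_space \<Rightarrow> 'a \<Rightarrow> real) \<Rightarrow> 'a set \<Rightarrow> bool" where
  "lagrangian \<sigma> V \<longleftrightarrow> subspace V \<and> V = {v. \<forall>w\<in>V. \<sigma> v w = 0}"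

definition quadratic_form :: "('a::euclidean_space \<Rightarrow> real) \<Rightarrow> bool" where
  "quadratic_form H \<longleftrightarrow> (\<exists>b. bilinear b \<and> (\<forall>v w. b v w = b w v) \<and> (\<forall>v. H v = b v v))"

definition LQ_problem ::
  "('a::euclidean_space \<Rightarrow> 'a \<Rightarrow> real) \<Rightarrow> ('a \<Rightarrow> real) \<Rightarrow> 'a set \<Rightarrow> bool" where
  "LQ_problem \<sigma> H V \<longleftrightarrow>
     symplectic_form \<sigma> \<and> quadratic_form H \<and> lagrangian \<sigma> V \<and> (\<forall>v\<in>V. H v \<ge> 0)"

text \<open>\<open>p\<close> and \<open>x\<close> collect the coordinate functions \<open>p\<^sub>i\<close>, \<open>x\<^sub>i\<close>; the last conjunct is
  \<open>\<sigma> = \<Sum>\<^sub>i dp\<^sub>i \<and> dx\<^sub>i\<close>, which also fixes the sign convention of the wedge product.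
  The space then has dimension \<open>2 * CARD('n)\<close>.\<close>

definition darboux_coordinates ::
  "('a::euclidean_space \<Rightarrow> 'a \<Rightarrow> real) \<Rightarrow> ('a \<Rightarrow> real ^ 'n) \<Rightarrow> ('a \<Rightarrow> real ^ 'n) \<Rightarrow> bool" where
  "darboux_coordinates \<sigma> p x \<longleftrightarrow>
     linear p \<and> linear x \<and> bij (\<lambda>z. (p z, x z)) \<and>
     (\<forall>u v. \<sigma> u v = (\<Sum>i\<in>UNIV. p u $ i * x v $ i - p v $ i * x u $ i))"

text \<open>\<open>((**) A ^^ i) B\<close> is \<open>A\<^sup>i B\<close> (the operation \<open>^\<close> on matrices would be componentwise).
  The rank of the block matrix \<open>(B, A B, \<dots>, A\<^sup>m\<^sup>-\<^sup>1 B)\<close> is the dimension of the span of the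
  columns of all its blocks.\<close>

definition kalman_rank_condition :: "real ^ 'n ^ 'n \<Rightarrow> real ^ 'k ^ 'n \<Rightarrow> bool" where
  "kalman_rank_condition A B \<longleftrightarrow>
     (\<exists>m>0. dim (\<Union>i<m. columns (((**) A ^^ i) B)) = CARD('n))"

text \<open>The type arguments give the number \<open>CARD('n)\<close> of degrees of freedom and the number
  \<open>CARD('k)\<close> of columns of \<open>B\<close>, neither of which can be quantified on the right-hand side.\<close>

definition controllable ::
  "'n::finite itself \<Rightarrow> 'k::finite itself \<Rightarrow>
     ('a::euclidean_space \<Rightarrow> 'a \<Rightarrow> real) \<Rightarrow> ('a \<Rightarrow> real) \<Rightarrow> 'a set \<Rightarrow> bool" where
  "controllable _ _ \<sigma> H V \<longleftrightarrow>
     (\<exists>(p :: 'a \<Rightarrow> real ^ 'n) (x :: 'a \<Rightarrow> real ^ 'n)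
        (A :: real ^ 'n ^ 'n) (B :: real ^ 'k ^ 'n) (Q :: real ^ 'n ^ 'n).
        darboux_coordinates \<sigma> p x \<and> V = {z. x z = 0} \<and> transpose Q = Q \<and>
        (\<forall>z. H z = 1 / 2 * (p z \<bullet> ((B ** transpose B) *v p z)
                            + 2 * (p z \<bullet> (A *v x z)) + x z \<bullet> (Q *v x z))) \<and>
        kalman_rank_condition A B)"

text \<open>The vector field \<open>X\<close> with \<open>dH(\<cdot>) = \<sigma>(\<cdot>, X)\<close> at every point; for a quadratic form
  \<open>H\<close> and a symplectic form \<open>\<sigma>\<close> it exists, is unique and is linear.\<close>

definition hamiltonian_field ::
  "('a::euclidean_space \<Rightarrow> 'a \<Rightarrow> real) \<Rightarrow> ('a \<Rightarrow> real) \<Rightarrow> 'a \<Rightarrow> 'a" where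
  "hamiltonian_field \<sigma> H = (THE X. \<forall>z. (H has_derivative (\<lambda>v. \<sigma> v (X z))) (at z))"

definition lin_exp :: "('a::euclidean_space \<Rightarrow> 'a) \<Rightarrow> 'a \<Rightarrow> 'a" where
  "lin_exp L v = (\<Sum>k. (L ^^ k) v /\<^sub>R fact k)"

definition jacobi_curve ::
  "('a::euclidean_space \<Rightarrow> 'a \<Rightarrow> real) \<Rightarrow> ('a \<Rightarrow> real) \<Rightarrow> 'a set \<Rightarrow> real \<Rightarrow> 'a set" where
  "jacobi_curve \<sigma> H V t = lin_exp (\<lambda>z. (- t) *\<^sub>R hamiltonian_field \<sigma> H z) ` V"

definition conjugate_time ::
  "('a::euclidean_space \<Rightarrow> 'a \<Rightarrow> real) \<Rightarrow> ('a \<Rightarrow> real) \<Rightarrow> 'a set \<Rightarrow> real \<Rightarrow> bool" where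
  "conjugate_time \<sigma> H V t \<longleftrightarrow> t \<noteq> 0 \<and> jacobi_curve \<sigma> H V t \<inter> V \<noteq> {0}"

definition conjugate_multiplicity ::
  "('a::euclidean_space \<Rightarrow> 'a \<Rightarrow> real) \<Rightarrow> ('a \<Rightarrow> real) \<Rightarrow> 'a set \<Rightarrow> real \<Rightarrow> nat" where
  "conjugate_multiplicity \<sigma> H V t = dim (jacobi_curve \<sigma> H V t \<inter> V)"

text \<open>The number of conjugate times in \<open>S\<close> counted with multiplicity; the supremum over finite
  subsets yields \<open>\<infinity>\<close> if there are infinitely many.\<close>

definition num_conjugate_times ::
  "('a::euclidean_space \<Rightarrow> 'a \<Rightarrow> real) \<Rightarrow> ('a \<Rightarrow> real) \<Rightarrow> 'a set \<Rightarrow> real set \<Rightarrow> enat" where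
  "num_conjugate_times \<sigma> H V S =
     (SUP F \<in> {F. finite F \<and> F \<subseteq> {t \<in> S. conjugate_time \<sigma> H V t}}.
        \<Sum>t\<in>F. enat (conjugate_multiplicity \<sigma> H V t))"

text \<open>Extended real valued, so that the infimum of the empty set is \<open>\<infinity>\<close>.\<close>

definition first_conjugate_time ::
  "('a::euclidean_space \<Rightarrow> 'a \<Rightarrow> real) \<Rightarrow> ('a \<Rightarrow> real) \<Rightarrow> 'a set \<Rightarrow> ereal" where
  "first_conjugate_time \<sigma> H V = Inf (ereal ` {t. t > 0 \<and> jacobi_curve \<sigma> H V t \<inter> V \<noteq> {0}})"

end

theory Submission
  imports Defs
begin

text \<open>
  In the coordinates \<open>\<zeta> = x + i p\<close> the flow of \<open>H\<close> for time \<open>-t\<close> is the unitary diagonal matrix \<open>D(t)\<close> with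
  entries \<open>exp (i t w\<^sub>j)\<close>, and the Lagrangian subspace is \<open>V = U \<real>\<^sup>n\<close> with \<open>U\<close> unitary.  Put
  \<open>M(t) = U\<^sup>* D(t) U\<close>.  Then \<open>D(t) V \<inter> V\<close> has the dimension of the eigenspace for the eigenvalue 1 of the
  symmetric unitary matrix \<open>W(t) = M(t)\<^sup>T M(t)\<close>, while \<open>det W(t) = exp (2 i t \<Sum> w\<^sub>j)\<close>.  If \<open>s(t)\<close> is the
  sum of the eigenvalue phases of \<open>W(t)\<close> taken in \<open>[0, 2\<pi>)\<close>, then \<open>g(t) = (2 t \<Sum> w\<^sub>j - s(t)) / 2\<pi>\<close> is an
  integer; it changes only at conjugate times, and there by at most the multiplicity.  As \<open>g(0) = 0\<close>
  and \<open>s < 2\<pi>n\<close>, the number of conjugate times in \<open>(0, T]\<close> exceeds \<open>T (\<Sum> w\<^sub>j) / \<pi> - n\<close>.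
  Finally \<open>\<Sum> w\<^sub>j\<close> is the trace of \<open>2 H\<close> restricted to \<open>V\<close>, hence positive by controllability.
\<close>

section \<open>Simultaneous diagonalization\<close>

text \<open>A maximizer \<open>v\<close> of \<open>f y \<bullet> y\<close> on the unit sphere of
  \<open>S\<close> is an eigenvector: the form \<open>c * (y \<bullet> y) - f y \<bullet> y\<close>
  is nonnegative on \<open>S\<close> and vanishes at \<open>v\<close>, so its first-order
  coefficient at \<open>v\<close> along the residual \<open>e\<close>, which is
  \<open>2 * (e \<bullet> e)\<close>, must be zero.\<close>

lemma self_adjoint_eigenvector:
  fixes f :: "'e::euclidean_space \<Rightarrow> 'e"
  assumes lin: "linear f" and sa: "\<And>x y. f x \<bullet> y = x \<bullet> f y"
    and S: "subspace S" "S \<noteq> {0}" "f ` S \<subseteq> S"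
  obtains v c where "v \<in> S" "norm v = 1" "f v = c *\<^sub>R v"
proof -
  let ?K = "S \<inter> sphere 0 1"
  have cf: "continuous_on A f" for A
    using lin linear_continuous_on linear_conv_bounded_linear by blast
  obtain u where u: "u \<in> S" "u \<noteq> 0"
    using S subspace_0 by blast
  then have "u /\<^sub>R norm u \<in> ?K"
    using S by (auto intro: subspace_scale)
  then have "?K \<noteq> {}" by blast
  moreover have "compact ?K"
    by (intro closed_Int_compact closed_subspace S) simp
  moreover have "continuous_on ?K (\<lambda>x. f x \<bullet> x)"
    by (intro continuous_intros cf)
  ultimately obtain v where "v \<in> ?K" and "\<forall>y\<in>?K. f y \<bullet> y \<le> f v \<bullet> v"
    using continuous_attains_sup[of ?K "\<lambda>x. f x \<bullet> x"] by blast
  then have v: "v \<in> S" "norm v = 1"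
    and max: "\<And>y. y \<in> S \<Longrightarrow> norm y = 1 \<Longrightarrow> f y \<bullet> y \<le> f v \<bullet> v"
    by auto
  define c where "c = f v \<bullet> v"
  have psd: "f y \<bullet> y \<le> c * (y \<bullet> y)" if "y \<in> S" for y
  proof (cases "y = 0")
    case False
    have "f (y /\<^sub>R norm y) \<bullet> (y /\<^sub>R norm y) \<le> c"
      unfolding c_def using that S False by (intro max) (auto intro: subspace_scale)
    moreover have "f (y /\<^sub>R norm y) \<bullet> (y /\<^sub>R norm y) = (f y \<bullet> y) / (norm y)\<^sup>2"
      unfolding linear_scale[OF lin] by (simp add: power2_eq_square divide_simps)
    ultimately have "(f y \<bullet> y) / (norm y)\<^sup>2 \<le> c"
      by linarith
    then show ?thesis
      using False by (simp add: divide_simps dot_square_norm)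
  qed (simp add: linear_0[OF lin])
  define e where "e = c *\<^sub>R v - f v"
  have e: "e \<in> S"
    unfolding e_def using v S by (auto intro: subspace_diff subspace_scale)
  define k where "k = c * (e \<bullet> e) - f e \<bullet> e"
  have k: "k \<ge> 0"
    using psd[OF e] by (simp add: k_def)
  have vv: "v \<bullet> v = 1"
    using v by (simp add: dot_square_norm)
  have *: "2 * s * (e \<bullet> e) + s\<^sup>2 * k \<ge> 0" for s
  proof -
    have "f (v + s *\<^sub>R e) \<bullet> (v + s *\<^sub>R e) \<le> c * ((v + s *\<^sub>R e) \<bullet> (v + s *\<^sub>R e))"
      using v e S by (intro psd) (auto intro: subspace_add subspace_scale)
    moreover have "f e \<bullet> v = e \<bullet> f v" by (rule sa)
    ultimately have "0 \<le> 2 * s * (c * (v \<bullet> e) - f v \<bullet> e) + s\<^sup>2 * k"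
      using vv c_def
      by (simp add: linear_add[OF lin] linear_scale[OF lin] inner_add_left inner_add_right k_def
          algebra_simps power2_eq_square inner_commute)
    moreover have "c * (v \<bullet> e) - f v \<bullet> e = e \<bullet> e"
      by (simp add: e_def inner_diff_left)
    ultimately show ?thesis by simp
  qed
  have "e \<bullet> e = 0"
  proof (rule ccontr)
    assume "e \<bullet> e \<noteq> 0"
    then have a: "e \<bullet> e > 0" by simp
    define a where "a = e \<bullet> e"
    \<comment> \<open>The quadratic in \<open>s\<close> has positive slope at 0, so a small negative
      \<open>s\<close> makes it negative. Its vertex \<open>- a / k\<close> is undefined for
      \<open>k = 0\<close>; with \<open>k + 1\<close> as denominator the value is still
      negative.\<close>
    have "2 * (- a / (k + 1)) * a + (- a / (k + 1))\<^sup>2 * k = - (a\<^sup>2 * (k + 2)) / (k + 1)\<^sup>2"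
      using k by (simp add: power2_eq_square divide_simps) (simp add: algebra_simps)
    moreover have "\<dots> < 0"
      using k a by (simp add: a_def divide_neg_pos)
    ultimately show False
      using *[of "- a / (k + 1)"] by (simp add: a_def)
  qed
  then have "f v = c *\<^sub>R v"
    by (simp add: e_def)
  with v show ?thesis using that by blast
qed

text \<open>Commutation makes an eigenspace of \<open>f\<close> in \<open>S\<close> invariant under
  \<open>g\<close>, so \<open>g\<close> has an eigenvector \<open>v\<close> there, common to both
  maps. Self-adjointness keeps the complement of \<open>v\<close> in \<open>S\<close> invariant
  under both, and induction on the dimension applies to it.\<close>

lemma commuting_self_adjoint_eigenbasis:
  fixes f g :: "'e::euclidean_space \<Rightarrow> 'e"
  assumes f: "linear f" "\<And>x y. f x \<bullet> y = x \<bullet> f y"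
    and g: "linear g" "\<And>x y. g x \<bullet> y = x \<bullet> g y"
    and fg: "\<And>x. f (g x) = g (f x)"
    and S: "subspace S" "f ` S \<subseteq> S" "g ` S \<subseteq> S"
  shows "\<exists>B. B \<subseteq> S \<and> span B = S \<and> pairwise orthogonal B \<and>
           (\<forall>b\<in>B. norm b = 1 \<and> (\<exists>c. f b = c *\<^sub>R b) \<and> (\<exists>c. g b = c *\<^sub>R b))"
  using S
proof (induction "dim S" arbitrary: S rule: less_induct)
  case less
  show ?case
  proof (cases "S = {0}")
    case True
    then show ?thesis by (intro exI[of _ "{}"]) auto
  next
    case False
    obtain u c where u: "u \<in> S" "norm u = 1" "f u = c *\<^sub>R u"
      using self_adjoint_eigenvector[OF f less.prems(1) False less.prems(2)] by blast
    let ?E = "{x \<in> S. f x = c *\<^sub>R x}"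
    have "subspace ?E"
      using less.prems(1) unfolding subspace_def
      by (simp add: linear_0[OF f(1)] linear_add[OF f(1)] linear_scale[OF f(1)] scaleR_add_right)
    moreover have "u \<in> ?E" "u \<noteq> 0"
      using u by auto
    then have "?E \<noteq> {0}"
      by blast
    moreover have "g ` ?E \<subseteq> ?E"
      using less.prems(3) by (auto simp: fg linear_scale[OF g(1)])
    ultimately obtain v d where "v \<in> ?E" "norm v = 1" "g v = d *\<^sub>R v"
      using self_adjoint_eigenvector[OF g, of ?E] by metis
    then have v: "v \<in> S" "f v = c *\<^sub>R v" "norm v = 1" "g v = d *\<^sub>R v"
      by auto
    let ?S = "{x \<in> S. v \<bullet> x = 0}"
    have sub: "subspace ?S"
      using less.prems(1) unfolding subspace_def by (simp add: inner_add_right)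
    have vv: "v \<bullet> v = 1"
      using v by (simp add: dot_square_norm)
    then have "?S \<subset> S"
      using v by force
    then have "dim ?S < dim S"
      using sub less.prems(1) by (intro dim_psubset) (simp add: span_eq_iff[THEN iffD2])
    moreover have "f ` ?S \<subseteq> ?S" "g ` ?S \<subseteq> ?S"
      using less.prems f(2)[of v, symmetric] g(2)[of v, symmetric] v by auto
    ultimately obtain B where B: "B \<subseteq> ?S" "span B = ?S" "pairwise orthogonal B"
       "\<forall>b\<in>B. norm b = 1 \<and> (\<exists>c. f b = c *\<^sub>R b) \<and> (\<exists>c. g b = c *\<^sub>R b)"
      using less.hyps[OF _ sub] by blast
    have "S \<subseteq> span (insert v B)"
    proof
      fix x assume "x \<in> S"
      then have "x - (v \<bullet> x) *\<^sub>R v \<in> ?S"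
        using v vv less.prems(1) by (auto intro: subspace_diff subspace_scale simp: inner_diff_right)
      then show "x \<in> span (insert v B)"
        using B(2) span_breakdown_eq by blast
    qed
    moreover have "span (insert v B) \<subseteq> S"
      using B(1) v(1) less.prems(1) by (intro span_minimal) auto
    moreover have "pairwise orthogonal (insert v B)"
      using B(1,3) by (auto simp: pairwise_insert orthogonal_def inner_commute)
    moreover have "insert v B \<subseteq> S"
      using B(1) v(1) by auto
    moreover have "\<forall>b\<in>insert v B. norm b = 1 \<and> (\<exists>c. f b = c *\<^sub>R b) \<and> (\<exists>c. g b = c *\<^sub>R b)"
      using B(4) v by blast
    ultimately show ?thesis
      by blast
  qed
qed

section \<open>Real eigenvectors of symmetric unitary matrices\<close>

definition cvec :: "real ^ 'n \<Rightarrow> complex ^ 'n" where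
  "cvec r = (\<chi> i. of_real (r $ i))"

text \<open>For a symmetric matrix the entrywise conjugate is the adjoint, so the second conjunct is
  unitarity.\<close>

definition symmetric_unitary :: "complex ^ 'n ^ 'n \<Rightarrow> bool" where
  "symmetric_unitary W \<longleftrightarrow> transpose W = W \<and> (\<chi> i j. cnj (W $ i $ j)) ** W = mat 1"

text \<open>The rows of \<open>R\<close> are the eigenvectors.\<close>

definition eigen_frame :: "complex ^ 'n ^ 'n \<Rightarrow> real ^ 'n ^ 'n \<Rightarrow> real ^ 'n \<Rightarrow> bool" where
  "eigen_frame W R \<theta> \<longleftrightarrow> R ** transpose R = mat 1 \<and>
     (\<forall>k. W *v cvec (R $ k) = cis (\<theta> $ k) *s cvec (R $ k))"

text \<open>For a symmetric unitary matrix the complex eigenspace for the eigenvalue 1 is the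
  complexification of this real space, whose dimension is therefore the multiplicity of that
  eigenvalue.\<close>

definition fixed_space :: "complex ^ 'n ^ 'n \<Rightarrow> (real ^ 'n) set" where
  "fixed_space W = {r. W *v cvec r = cvec r}"

lemma cvec_nth [simp]: "cvec r $ i = of_real (r $ i)"
  by (simp add: cvec_def)

lemma row_orthonormal_iff:
  fixes R :: "real ^ 'n ^ 'n"
  shows "R ** transpose R = mat 1 \<longleftrightarrow> (\<forall>i j. R $ i \<bullet> R $ j = (if i = j then 1 else 0))"
  by (simp add: vec_eq_iff matrix_matrix_mult_def transpose_def mat_def inner_vec_def)

lemma matrix_vector_mult_cvec:
  "(W *v cvec r) $ i =
     Complex (((\<chi> i j. Re (W $ i $ j)) *v r) $ i) (((\<chi> i j. Im (W $ i $ j)) *v r) $ i)"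
  by (simp add: matrix_vector_mult_def complex_eq_iff)

lemma symmetric_matrix_self_adjoint:
  fixes X :: "real ^ 'n ^ 'n"
  assumes "transpose X = X"
  shows "(X *v a) \<bullet> b = a \<bullet> (X *v b)"
  using dot_lmul_matrix[of a X b] transpose_matrix_vector[of X a] assms by simp

lemma transpose_eq_self_nth:
  assumes "transpose W = W"
  shows "W $ i $ j = W $ j $ i"
proof -
  have "transpose W $ i $ j = W $ j $ i"
    by (simp add: transpose_def)
  then show ?thesis using assms by simp
qed

text \<open>Write \<open>W = X + \<i> Y\<close> with real symmetric \<open>X\<close> and
  \<open>Y\<close>. The real part of the unitarity equation is
  \<open>X ** X + Y ** Y = mat 1\<close>, the imaginary part says that \<open>X\<close> and
  \<open>Y\<close> commute. A common real orthonormal eigenbasis diagonalizes \<open>W\<close>, and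
  its eigenvalues \<open>c + \<i> d\<close> have modulus 1.\<close>

lemma ex_eigen_frame:
  fixes W :: "complex ^ 'n ^ 'n"
  assumes W: "symmetric_unitary W"
  shows "\<exists>R \<theta>. eigen_frame W R \<theta> \<and> (\<forall>k. 0 \<le> \<theta> $ k \<and> \<theta> $ k < 2 * pi)"
proof -
  define X :: "real ^ 'n ^ 'n" where "X = (\<chi> i j. Re (W $ i $ j))"
  define Y :: "real ^ 'n ^ 'n" where "Y = (\<chi> i j. Im (W $ i $ j))"
  have sym: "W $ i $ j = W $ j $ i" for i j
    using W by (intro transpose_eq_self_nth) (simp add: symmetric_unitary_def)
  have "transpose X = X" "transpose Y = Y"
    by (simp_all add: X_def Y_def transpose_def vec_eq_iff sym[symmetric])
  note sa = this[THEN symmetric_matrix_self_adjoint]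
  have *: "(\<Sum>k\<in>UNIV. cnj (W $ i $ k) * W $ k $ j) = (if i = j then 1 else 0)" for i j
    using W by (simp add: symmetric_unitary_def vec_eq_iff matrix_matrix_mult_def mat_def)
  have "Re (\<Sum>k\<in>UNIV. cnj (W $ i $ k) * W $ k $ j) = (if i = j then 1 else 0)"
    "Im (\<Sum>k\<in>UNIV. cnj (W $ i $ k) * W $ k $ j) = 0" for i j
    by (simp_all add: *)
  then have sq: "X ** X + Y ** Y = mat 1" and "X ** Y = Y ** X"
    by (simp_all add: vec_eq_iff matrix_matrix_mult_def mat_def X_def Y_def
        sum.distrib sum_subtractf)
  then have comm: "X *v (Y *v r) = Y *v (X *v r)" for r
    by (simp add: matrix_vector_mul_assoc)
  obtain B where B: "span B = UNIV" "pairwise orthogonal B"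
    and eig: "\<And>b. b \<in> B \<Longrightarrow> norm b = 1 \<and> (\<exists>c. X *v b = c *\<^sub>R b) \<and> (\<exists>c. Y *v b = c *\<^sub>R b)"
    using commuting_self_adjoint_eigenbasis[of "(*v) X" "(*v) Y" UNIV] sa comm by auto
  have "0 \<notin> B"
    using eig by fastforce
  then have "independent B"
    using B pairwise_orthogonal_independent by blast
  then have "finite B" "card B = CARD('n)"
    using B independent_imp_finite[of B] dim_eq_card_independent[of B] dim_span[of B] by auto
  then obtain r :: "'n \<Rightarrow> real ^ 'n" where r: "bij_betw r UNIV B"
    using finite_same_card_bij[of "UNIV :: 'n set" B] by auto
  then have rB: "r k \<in> B" for k
    by (auto simp: bij_betw_def)
  define R where "R = (\<chi> k. r k)"
  have ort: "r i \<bullet> r j = (if i = j then 1 else 0)" for i j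
  proof (cases "i = j")
    case True
    then show ?thesis using eig[OF rB] by (simp add: dot_square_norm)
  next
    case False
    then have "r i \<noteq> r j"
      using r by (auto simp: bij_betw_def inj_on_def)
    with False B(2) rB show ?thesis
      by (simp add: pairwise_def orthogonal_def)
  qed
  have "\<exists>t. 0 \<le> t \<and> t < 2 * pi \<and> W *v cvec (r k) = cis t *s cvec (r k)" for k
  proof -
    obtain c d where cd: "X *v r k = c *\<^sub>R r k" "Y *v r k = d *\<^sub>R r k"
      using eig[OF rB] by meson
    have "r k = (X ** X + Y ** Y) *v r k"
      by (simp add: sq)
    also have "\<dots> = X *v (X *v r k) + Y *v (Y *v r k)"
      by (simp add: matrix_vector_mult_add_rdistrib matrix_vector_mul_assoc)
    also have "\<dots> = (c\<^sup>2 + d\<^sup>2) *\<^sub>R r k"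
      by (simp add: cd matrix_vector_mult_scaleR scaleR_add_left power2_eq_square)
    finally have "(c\<^sup>2 + d\<^sup>2 - 1) *\<^sub>R r k = 0"
      by (simp add: algebra_simps)
    moreover have "r k \<noteq> 0"
      using rB \<open>0 \<notin> B\<close> by metis
    ultimately have "norm (Complex c d) = 1"
      by (simp add: cmod_def)
    then have "cis (Arg2pi (Complex c d)) = Complex c d"
      by (metis cis_conv_exp complex_norm_eq_1_exp)
    moreover have "W *v cvec (r k) = Complex c d *s cvec (r k)"
      by (simp add: vec_eq_iff matrix_vector_mult_cvec X_def[symmetric] Y_def[symmetric] cd
          complex_eq_iff)
    ultimately show ?thesis
      using Arg2pi_ge_0 Arg2pi_lt_2pi by metis
  qed
  then obtain t where t: "\<And>k. 0 \<le> t k \<and> t k < 2 * pi \<and> W *v cvec (r k) = cis (t k) *s cvec (r k)"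
    by metis
  have "eigen_frame W R (\<chi> k. t k)"
    using t ort by (simp add: eigen_frame_def row_orthonormal_iff R_def)
  then show ?thesis
    using t by (intro exI[of _ R] exI[of _ "\<chi> k. t k"]) simp
qed

lemma cis_sum: "finite A \<Longrightarrow> cis (sum f A) = (\<Prod>a\<in>A. cis (f a))"
  by (induction A rule: finite_induct) (auto simp: cis_mult[symmetric])

text \<open>The eigenvectors as columns form a real orthogonal, hence invertible, matrix
  \<open>C\<close> with \<open>W ** C = C ** D\<close>; cancelling \<open>det C\<close> leaves the
  product of the eigenvalues.\<close>

lemma det_eigen_frame:
  fixes W :: "complex ^ 'n ^ 'n"
  assumes "eigen_frame W R \<theta>"
  shows "det W = cis (\<Sum>k\<in>UNIV. \<theta> $ k)"
proof -
  define C :: "complex ^ 'n ^ 'n" where "C = (\<chi> i j. of_real (R $ j $ i))"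
  define D :: "complex ^ 'n ^ 'n" where "D = (\<chi> i j. if i = j then cis (\<theta> $ j) else 0)"
  have "(\<Sum>k\<in>UNIV. R $ i $ k * R $ j $ k) = (if i = j then 1 else 0)" for i j
    using assms by (simp add: eigen_frame_def row_orthonormal_iff inner_vec_def)
  then have "(\<Sum>k\<in>UNIV. C $ k $ i * C $ k $ j) = (if i = j then 1 else 0)" for i j
    by (simp add: C_def flip: of_real_mult of_real_sum)
  then have "transpose C ** C = mat 1"
    by (simp add: matrix_matrix_mult_def transpose_def mat_def vec_eq_iff)
  then have "det C \<noteq> 0"
    using det_mul[of "transpose C" C] by auto
  have "(W *v cvec (R $ j)) $ i = (cis (\<theta> $ j) *s cvec (R $ j)) $ i" for i j
    using assms by (simp add: eigen_frame_def)
  then have "W ** C = C ** D"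
    by (simp add: vec_eq_iff matrix_matrix_mult_def matrix_vector_mult_def C_def D_def
        if_distrib[of "(*) _"] cong: if_cong)
  then have "det W * det C = det C * det D"
    by (metis det_mul)
  then have "det W = det D"
    using \<open>det C \<noteq> 0\<close> by simp
  also have "\<dots> = (\<Prod>k\<in>UNIV. cis (\<theta> $ k))"
    unfolding D_def by (subst det_diagonal) auto
  finally show ?thesis
    by (simp add: cis_sum)
qed

text \<open>The squares of the entries of the transition matrix between two frames form a doubly stochastic
  matrix that couples equal eigenvalues only.\<close>

lemma eigen_frame_sum_eq:
  fixes h :: "complex \<Rightarrow> real" and W :: "complex ^ 'n ^ 'n"
  assumes W: "transpose W = W" and R: "eigen_frame W R \<theta>" and R': "eigen_frame W R' \<theta>'"
  shows "(\<Sum>k\<in>UNIV. h (cis (\<theta> $ k))) = (\<Sum>k\<in>UNIV. h (cis (\<theta>' $ k)))"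
proof -
  define G where "G = R ** transpose R'"
  have G: "G $ k $ l = R $ k \<bullet> R' $ l" for k l
    by (simp add: G_def matrix_matrix_mult_def transpose_def inner_vec_def)
  have "transpose R ** R = mat 1" "transpose R' ** R' = mat 1"
    "R ** transpose R = mat 1" "R' ** transpose R' = mat 1"
    using R R' by (auto simp: eigen_frame_def intro: matrix_left_right_inverse1)
  moreover have "G ** transpose G = R ** (transpose R' ** R') ** transpose R"
    by (simp add: G_def matrix_transpose_mul matrix_mul_assoc)
  moreover have "transpose G ** G = R' ** (transpose R ** R) ** transpose R'"
    by (simp add: G_def matrix_transpose_mul matrix_mul_assoc)
  ultimately have "G ** transpose G = mat 1" "transpose G ** G = mat 1"
    by (simp_all)
  then have rows: "(\<Sum>l\<in>UNIV. (G $ k $ l)\<^sup>2) = 1" and cols: "(\<Sum>l\<in>UNIV. (G $ l $ k)\<^sup>2) = 1" for k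
    by (simp_all add: vec_eq_iff matrix_matrix_mult_def transpose_def mat_def power2_eq_square)
  note sym = transpose_eq_self_nth[OF W]
  have eq: "cis (\<theta> $ k) = cis (\<theta>' $ l)" if "G $ k $ l \<noteq> 0" for k l
  proof -
    let ?a = "cvec (R $ k)" and ?b = "cvec (R' $ l)"
    \<comment> \<open>The product is bilinear, without conjugation: the symmetry of \<open>W\<close>
      makes \<open>W\<close> self-adjoint for it, and on real vectors it is the real inner
      product.\<close>
    let ?dot = "\<lambda>a b :: complex ^ 'n. \<Sum>i\<in>UNIV. a $ i * b $ i"
    have ab: "?dot ?a ?b = of_real (G $ k $ l)"
      by (simp add: G inner_vec_def)
    have "?dot (W *v ?a) ?b = (\<Sum>i\<in>UNIV. \<Sum>j\<in>UNIV. W $ i $ j * ?a $ j * ?b $ i)"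
      by (simp add: matrix_vector_mult_def sum_distrib_right)
    also have "\<dots> = (\<Sum>j\<in>UNIV. \<Sum>i\<in>UNIV. W $ i $ j * ?a $ j * ?b $ i)"
      by (rule sum.swap)
    also have "\<dots> = (\<Sum>j\<in>UNIV. \<Sum>i\<in>UNIV. ?a $ j * (W $ j $ i * ?b $ i))"
      by (intro sum.cong refl) (simp add: sym mult_ac)
    also have "\<dots> = ?dot ?a (W *v ?b)"
      by (simp add: matrix_vector_mult_def sum_distrib_left)
    finally have "?dot (W *v ?a) ?b = ?dot ?a (W *v ?b)" .
    moreover have "?dot (W *v ?a) ?b = cis (\<theta> $ k) * ?dot ?a ?b"
      using R by (simp add: eigen_frame_def sum_distrib_left mult.assoc)
    moreover have "?dot ?a (W *v ?b) = cis (\<theta>' $ l) * ?dot ?a ?b"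
      using R' by (simp add: eigen_frame_def sum_distrib_left mult_ac)
    ultimately show ?thesis
      using that unfolding ab by simp
  qed
  have "(\<Sum>k\<in>UNIV. h (cis (\<theta> $ k))) = (\<Sum>k\<in>UNIV. \<Sum>l\<in>UNIV. (G $ k $ l)\<^sup>2 * h (cis (\<theta> $ k)))"
    by (simp add: rows flip: sum_distrib_right)
  also have "\<dots> = (\<Sum>k\<in>UNIV. \<Sum>l\<in>UNIV. (G $ k $ l)\<^sup>2 * h (cis (\<theta>' $ l)))"
  proof (intro sum.cong refl)
    show "(G $ k $ l)\<^sup>2 * h (cis (\<theta> $ k)) = (G $ k $ l)\<^sup>2 * h (cis (\<theta>' $ l))" for k l
      by (cases "G $ k $ l = 0") (simp_all add: eq[of k l])
  qed
  also have "\<dots> = (\<Sum>l\<in>UNIV. \<Sum>k\<in>UNIV. (G $ k $ l)\<^sup>2 * h (cis (\<theta>' $ l)))"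
    by (rule sum.swap)
  also have "\<dots> = (\<Sum>l\<in>UNIV. h (cis (\<theta>' $ l)))"
    by (simp add: cols flip: sum_distrib_right)
  finally show ?thesis .
qed

section \<open>Eigenvalue phases of symmetric unitary matrices\<close>

text \<open>The choice is harmless: by \<open>eigen_frame_sum_eq\<close> every frame with phases in
  \<open>[0, 2 * pi)\<close> gives the same sum.\<close>

definition phase_sum :: "complex ^ 'n ^ 'n \<Rightarrow> real" where
  "phase_sum W = (SOME s. \<exists>R \<theta>. eigen_frame W R \<theta> \<and>
     (\<forall>k. 0 \<le> \<theta> $ k \<and> \<theta> $ k < 2 * pi) \<and> s = (\<Sum>k\<in>UNIV. \<theta> $ k))"

lemma phase_sumE:
  fixes W :: "complex ^ 'n ^ 'n"
  assumes "symmetric_unitary W"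
  obtains R \<theta> where "eigen_frame W R \<theta>" "\<And>k. 0 \<le> \<theta> $ k" "\<And>k. \<theta> $ k < 2 * pi"
    "phase_sum W = (\<Sum>k\<in>UNIV. \<theta> $ k)"
proof -
  have "\<exists>s R \<theta>. eigen_frame W R \<theta> \<and> (\<forall>k. 0 \<le> \<theta> $ k \<and> \<theta> $ k < 2 * pi) \<and> s = (\<Sum>k\<in>UNIV. \<theta> $ k)"
    using ex_eigen_frame[OF assms] by blast
  from someI_ex[OF this] obtain R \<theta> where "eigen_frame W R \<theta>"
    "\<forall>k. 0 \<le> \<theta> $ k \<and> \<theta> $ k < 2 * pi" "phase_sum W = (\<Sum>k\<in>UNIV. \<theta> $ k)"
    unfolding phase_sum_def[symmetric] by blast
  with that show ?thesis by blast
qed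

lemma phase_sum_eigen_frame:
  fixes W :: "complex ^ 'n ^ 'n"
  assumes W: "symmetric_unitary W" and R: "eigen_frame W R \<theta>"
    and \<theta>: "\<And>k. 0 \<le> \<theta> $ k" "\<And>k. \<theta> $ k \<le> 2 * pi"
  shows "phase_sum W = (\<Sum>k\<in>UNIV. \<theta> $ k) - 2 * pi * card {k. \<theta> $ k = 2 * pi}"
proof -
  obtain R' \<theta>' where R': "eigen_frame W R' \<theta>'" "\<And>k. 0 \<le> \<theta>' $ k" "\<And>k. \<theta>' $ k < 2 * pi"
    "phase_sum W = (\<Sum>k\<in>UNIV. \<theta>' $ k)"
    using phase_sumE[OF W] by blast
  have Arg: "Arg2pi (cis t) = t" if "0 \<le> t" "t < 2 * pi" for t
    using that by (intro Arg2pi_unique[of 1]) (auto simp: cis_conv_exp)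
  have "phase_sum W = (\<Sum>k\<in>UNIV. Arg2pi (cis (\<theta>' $ k)))"
    by (simp add: Arg R')
  also have "\<dots> = (\<Sum>k\<in>UNIV. Arg2pi (cis (\<theta> $ k)))"
    using W R R'(1) by (intro eigen_frame_sum_eq) (auto simp: symmetric_unitary_def)
  also have "\<dots> = (\<Sum>k\<in>UNIV. \<theta> $ k - (if \<theta> $ k = 2 * pi then 2 * pi else 0))"
  proof (intro sum.cong refl)
    fix k show "Arg2pi (cis (\<theta> $ k)) = \<theta> $ k - (if \<theta> $ k = 2 * pi then 2 * pi else 0)"
      using \<theta>[of k] Arg[of 0] Arg[of "\<theta> $ k"] by (cases "\<theta> $ k = 2 * pi") auto
  qed
  also have "\<dots> = (\<Sum>k\<in>UNIV. \<theta> $ k) - 2 * pi * card {k. \<theta> $ k = 2 * pi}"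
    by (simp add: sum_subtractf sum.If_cases)
  finally show ?thesis .
qed

text \<open>The eigenvectors for the eigenvalue 1 are orthonormal, hence independent. This turns the
  number of phases that reach \<open>2 * pi\<close> into a bound by the multiplicity.\<close>

lemma card_le_dim_fixed_space:
  fixes W :: "complex ^ 'n ^ 'n"
  assumes "eigen_frame W R \<theta>"
  shows "card {k. cis (\<theta> $ k) = 1} \<le> dim (fixed_space W)"
proof -
  let ?K = "{k. cis (\<theta> $ k) = 1}" and ?B = "($) R ` {k. cis (\<theta> $ k) = 1}"
  have ort: "R $ i \<bullet> R $ j = (if i = j then 1 else 0)" for i j
    using assms by (simp add: eigen_frame_def row_orthonormal_iff)
  have "inj (($) R)"
    by (rule injI) (metis ort zero_neq_one)
  then have "card ?B = card ?K"
    by (simp add: card_image inj_on_subset)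
  moreover have "pairwise orthogonal ?B"
    by (auto simp: pairwise_def orthogonal_def ort)
  moreover have "0 \<notin> ?B"
  proof
    assume "0 \<in> ?B"
    then obtain k where "R $ k = 0"
      by force
    with ort[of k k] show False
      by simp
  qed
  moreover have "?B \<subseteq> fixed_space W"
    using assms by (auto simp: eigen_frame_def fixed_space_def)
  ultimately show ?thesis
    by (metis independent_card_le_dim pairwise_orthogonal_independent)
qed

section \<open>Behaviour of phase sums under limits\<close>

lemma eigen_frame_closed:
  fixes W :: "nat \<Rightarrow> complex ^ 'n ^ 'n"
  assumes frame: "\<And>m. eigen_frame (W m) (R m) (\<theta> m)"
    and lim: "W \<longlonglongrightarrow> W'" "R \<longlonglongrightarrow> R'" "\<theta> \<longlonglongrightarrow> \<theta>'"
  shows "eigen_frame W' R' \<theta>'"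
  unfolding eigen_frame_def row_orthonormal_iff
proof (intro conjI allI)
  fix i j
  have "(\<lambda>m. R m $ i \<bullet> R m $ j) \<longlonglongrightarrow> R' $ i \<bullet> R' $ j"
    by (intro tendsto_intros lim)
  then show "R' $ i \<bullet> R' $ j = (if i = j then 1 else 0)"
    using frame by (simp add: eigen_frame_def row_orthonormal_iff LIMSEQ_const_iff)
next
  fix k
  have "(W' *v cvec (R' $ k)) $ i = (cis (\<theta>' $ k) *s cvec (R' $ k)) $ i" for i
  proof -
    have "(\<lambda>m. (W m *v cvec (R m $ k)) $ i) \<longlonglongrightarrow> (W' *v cvec (R' $ k)) $ i"
      unfolding matrix_vector_mult_def by (simp, intro tendsto_intros lim)
    moreover have "(\<lambda>m. (cis (\<theta> m $ k) *s cvec (R m $ k)) $ i) \<longlonglongrightarrow> (cis (\<theta>' $ k) *s cvec (R' $ k)) $ i"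
      unfolding cis_conv_exp by (simp, intro tendsto_intros lim)
    ultimately show ?thesis
      using frame LIMSEQ_unique unfolding eigen_frame_def by fastforce
  qed
  then show "W' *v cvec (R' $ k) = cis (\<theta>' $ k) *s cvec (R' $ k)"
    by (simp only: vec_eq_iff) blast
qed

lemma norm_vec_le:
  fixes x :: "'b::real_normed_vector ^ 'n"
  assumes "\<And>i. norm (x $ i) \<le> c"
  shows "norm x \<le> real CARD('n) * c"
proof -
  have "norm x \<le> (\<Sum>i\<in>UNIV. norm (x $ i))"
    unfolding norm_vec_def by (rule L2_set_le_sum) simp
  also have "\<dots> \<le> real CARD('n) * c"
    using sum_bounded_above[of UNIV "\<lambda>i. norm (x $ i)" c] assms by simp
  finally show ?thesis .
qed

text \<open>In the limit, phases slightly below \<open>2\<pi>\<close> may become eigenvalues 1, whose phase counts as 0.\<close>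

lemma phase_sum_limit:
  fixes W :: "nat \<Rightarrow> complex ^ 'n ^ 'n"
  assumes W: "\<And>m. symmetric_unitary (W m)" and W': "symmetric_unitary W'" and lim: "W \<longlonglongrightarrow> W'"
  obtains r s where "strict_mono (r :: nat \<Rightarrow> nat)" "(\<lambda>m. phase_sum (W (r m))) \<longlonglongrightarrow> s"
    "phase_sum W' \<le> s" "s \<le> phase_sum W' + 2 * pi * dim (fixed_space W')"
proof -
  have "\<exists>R \<theta>. eigen_frame (W m) R \<theta> \<and> (\<forall>k. 0 \<le> \<theta> $ k \<and> \<theta> $ k < 2 * pi) \<and>
     phase_sum (W m) = (\<Sum>k\<in>UNIV. \<theta> $ k)" for m
    using phase_sumE[OF W[of m]] by metis
  then obtain R \<theta> where frame: "\<And>m. eigen_frame (W m) (R m) (\<theta> m)"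
    and \<theta>: "\<And>m k. 0 \<le> \<theta> m $ k" "\<And>m k. \<theta> m $ k < 2 * pi"
    and sum: "\<And>m. phase_sum (W m) = (\<Sum>k\<in>UNIV. \<theta> m $ k)"
    by metis
  have "norm (\<theta> m) \<le> real CARD('n) * (2 * pi)" for m
    using \<theta>[of m] by (intro norm_vec_le) (simp add: less_imp_le)
  then have "bounded (range \<theta>)"
    unfolding bounded_iff by blast
  have "R m $ k \<bullet> R m $ k = 1" for m k
    using frame[of m] by (simp add: eigen_frame_def row_orthonormal_iff)
  then have "norm (R m) \<le> real CARD('n) * 1" for m
    by (intro norm_vec_le) (simp add: norm_eq_sqrt_inner)
  then have "bounded (range R)"
    unfolding bounded_iff by blast
  \<comment> \<open>Eigenvectors and phases need not depend continuously on the matrix, but both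
    stay bounded, so one subsequence makes them converge together.\<close>
  have "bounded (range (\<lambda>m. (R m, \<theta> m)))"
    by (rule bounded_subset[OF bounded_Times[OF \<open>bounded (range R)\<close> \<open>bounded (range \<theta>)\<close>]]) auto
  then obtain l and r :: "nat \<Rightarrow> nat"
    where r: "strict_mono r" and l: "((\<lambda>m. (R m, \<theta> m)) \<circ> r) \<longlonglongrightarrow> l"
    using bounded_imp_convergent_subsequence by blast
  define R' \<theta>' where "R' = fst l" and "\<theta>' = snd l"
  have R': "(\<lambda>m. R (r m)) \<longlonglongrightarrow> R'" and \<theta>': "(\<lambda>m. \<theta> (r m)) \<longlonglongrightarrow> \<theta>'"
    using tendsto_fst[OF l] tendsto_snd[OF l] by (simp_all add: R'_def \<theta>'_def o_def)
  have "(\<lambda>m. W (r m)) \<longlonglongrightarrow> W'"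
    using LIMSEQ_subseq_LIMSEQ[OF lim r] by (simp add: o_def)
  then have frame': "eigen_frame W' R' \<theta>'"
    by (rule eigen_frame_closed[where W = "\<lambda>m. W (r m)", OF frame _ R' \<theta>'])
  have lim_k: "(\<lambda>m. \<theta> (r m) $ k) \<longlonglongrightarrow> \<theta>' $ k" for k
    by (intro tendsto_intros \<theta>')
  have "0 \<le> \<theta>' $ k" for k
    using lim_k by (rule LIMSEQ_le_const) (simp add: \<theta>)
  moreover have "\<theta>' $ k \<le> 2 * pi" for k
    using lim_k by (rule LIMSEQ_le_const2) (use \<theta> less_imp_le in blast)
  ultimately have eq: "phase_sum W' = (\<Sum>k\<in>UNIV. \<theta>' $ k) - 2 * pi * card {k. \<theta>' $ k = 2 * pi}"
    by (intro phase_sum_eigen_frame[OF W' frame'])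
  have "card {k. \<theta>' $ k = 2 * pi} \<le> card {k. cis (\<theta>' $ k) = 1}"
    by (intro card_mono) auto
  also have "\<dots> \<le> dim (fixed_space W')"
    by (rule card_le_dim_fixed_space[OF frame'])
  finally have "2 * pi * card {k. \<theta>' $ k = 2 * pi} \<le> 2 * pi * dim (fixed_space W')"
    by simp
  moreover have "(\<lambda>m. phase_sum (W (r m))) \<longlonglongrightarrow> (\<Sum>k\<in>UNIV. \<theta>' $ k)"
    unfolding sum by (intro tendsto_intros \<theta>')
  ultimately show ?thesis
    using that[OF r] eq by simp
qed

text \<open>Near \<open>t0\<close> the phase sum can exceed its value at \<open>t0\<close> by whole
  turns, at most one per fixed dimension, but cannot fall below it, up to \<open>e\<close>. A
  sequence tending to \<open>t0\<close> and violating this would contradict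
  \<open>phase_sum_limit\<close>.\<close>

lemma eventually_phase_sum:
  fixes W :: "real \<Rightarrow> complex ^ 'n ^ 'n"
  assumes W: "\<And>t. symmetric_unitary (W t)" and cont: "isCont W t0" and e: "e > 0"
  shows "eventually (\<lambda>t. phase_sum (W t0) - e < phase_sum (W t) \<and>
    phase_sum (W t) < phase_sum (W t0) + 2 * pi * dim (fixed_space (W t0)) + e) (nhds t0)"
    (is "eventually ?P _")
proof (rule ccontr)
  assume "\<not> eventually ?P (nhds t0)"
  then have "\<exists>t. dist t t0 < 1 / real (Suc m) \<and> \<not> ?P t" for m
    unfolding eventually_nhds_metric
    by (metis of_nat_0_less_iff zero_less_Suc zero_less_divide_1_iff)
  then obtain f where f: "\<And>m. dist (f m) t0 < 1 / real (Suc m)" "\<And>m. \<not> ?P (f m)"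
    by metis
  have "(\<lambda>m. 1 / real (Suc m)) \<longlonglongrightarrow> 0"
    by (rule LIMSEQ_Suc[OF lim_1_over_n])
  then have "(\<lambda>m. dist (f m) t0) \<longlonglongrightarrow> 0"
    by (rule Lim_null_comparison[rotated]) (use f(1) less_imp_le in \<open>auto intro!: always_eventually\<close>)
  then have "f \<longlonglongrightarrow> t0"
    by (rule tendsto_dist_iff[THEN iffD2])
  then have "(\<lambda>m. W (f m)) \<longlonglongrightarrow> W t0"
    by (rule isCont_tendsto_compose[OF cont])
  then obtain r s where s: "(\<lambda>m. phase_sum (W (f (r m)))) \<longlonglongrightarrow> s"
    "phase_sum (W t0) \<le> s" "s \<le> phase_sum (W t0) + 2 * pi * dim (fixed_space (W t0))"
    using phase_sum_limit[of "\<lambda>m. W (f m)" "W t0"] W by metis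
  have "eventually (\<lambda>m. ?P (f (r m))) sequentially"
    by (intro eventually_conj order_tendstoD[OF s(1)]) (use s e in linarith)+
  then show False
    using f(2) by simp
qed

section \<open>Counting passages of an eigenvalue through 1\<close>

text \<open>By the local bounds \<open>g\<close> can rise only on arrival at a point, by at most
  \<open>d\<close> there, and never on departure. Subtracting the values of \<open>d\<close> met so
  far gives a function \<open>c\<close> with \<open>c b \<le> c x \<le> c a\<close> for
  \<open>a \<le> x \<le> b\<close> close to \<open>x\<close>; bisection extends this to the whole
  interval.\<close>

lemma integer_drop_bound:
  fixes g :: "real \<Rightarrow> int" and d :: "real \<Rightarrow> nat"
  assumes "0 \<le> T" and fin: "finite {t \<in> {0<..T}. d t \<noteq> 0}"
    and local: "\<And>t0. 0 \<le> t0 \<Longrightarrow> t0 \<le> T \<Longrightarrow>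
      eventually (\<lambda>t. g t0 - int (d t0) \<le> g t \<and> g t \<le> g t0) (nhds t0)"
  shows "g T - g 0 \<le> (\<Sum>t | t \<in> {0<..T} \<and> d t \<noteq> 0. int (d t))"
proof -
  define C where "C = {t \<in> {0<..T}. d t \<noteq> 0}"
  have fin: "finite C"
    using fin by (simp add: C_def)
  define c where "c t = g t - (\<Sum>s | s \<in> C \<and> s \<le> t. int (d s))" for t
  have "0 \<le> (0::real) \<longrightarrow> T \<le> T \<longrightarrow> c T \<le> c 0"
    using \<open>0 \<le> T\<close>
  proof (induction rule: Bolzano[where P = "\<lambda>a b. 0 \<le> a \<longrightarrow> b \<le> T \<longrightarrow> c b \<le> c a"])
    case (trans a b c)
    then show ?case by auto
  next
    case (local x)
    obtain e where e: "e > 0"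
      "\<And>t. dist t x < e \<Longrightarrow> g x - int (d x) \<le> g t \<and> g t \<le> g x"
      using assms(3)[OF local] unfolding eventually_nhds_metric by blast
    obtain e' where e': "e' > 0" "\<And>s. s \<in> C \<Longrightarrow> s \<noteq> x \<Longrightarrow> e' \<le> dist x s"
      using finite_set_avoid[OF fin, of x] by blast
    show ?case
    proof (intro exI[of _ "min e e'"] conjI allI impI)
      fix a b assume ab: "a \<le> x \<and> x \<le> b \<and> b - a < min e e'" and "0 \<le> a" "b \<le> T"
      have near: "s = x" if "s \<in> C" "a \<le> s" "s \<le> b" for s
        using e'(2)[OF that(1)] ab that by (force simp: dist_real_def)
      have "c x \<le> c a"
      proof (cases "a = x")
        case False
        have "{s. s \<in> C \<and> s \<le> x} = {s. s \<in> C \<and> s \<le> a} \<union> {s. s \<in> C \<and> s = x}"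
          using near ab by force
        then have "(\<Sum>s | s \<in> C \<and> s \<le> x. int (d s)) =
            (\<Sum>s | s \<in> C \<and> s \<le> a. int (d s)) + (\<Sum>s | s \<in> C \<and> s = x. int (d s))"
          using fin ab False by (subst sum.union_disjoint[symmetric]) auto
        also have "(\<Sum>s | s \<in> C \<and> s = x. int (d s)) = int (d x)"
        proof (cases "x \<in> C")
          case True
          then have "{s. s \<in> C \<and> s = x} = {x}" by auto
          then show ?thesis by simp
        next
          case nC: False
          \<comment> \<open>Here \<open>0 \<le> a < x \<le> T\<close>, so a point outside
            \<open>C\<close> has \<open>d x = 0\<close>. At \<open>x = 0\<close> also
            \<open>a = 0\<close>, hence the value \<open>d 0\<close>, in the application the full
            dimension of the Lagrangian subspace, is never counted.\<close>
          then have "d x = 0"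
            using ab False \<open>0 \<le> a\<close> \<open>b \<le> T\<close> by (auto simp: C_def)
          moreover have "{s. s \<in> C \<and> s = x} = {}"
            using nC by auto
          ultimately show ?thesis by simp
        qed
        finally show ?thesis
          using e(2)[of a] ab by (auto simp: c_def dist_real_def)
      qed simp
      moreover have "{s. s \<in> C \<and> s \<le> b} = {s. s \<in> C \<and> s \<le> x}"
        using near ab by force
      then have "c b \<le> c x"
        using e(2)[of b] ab by (auto simp: c_def dist_real_def)
      ultimately show "c b \<le> c a"
        by simp
    qed (use e e' in auto)
  qed
  moreover have "{s. s \<in> C \<and> s \<le> 0} = {}" "{s. s \<in> C \<and> s \<le> T} = C"
    by (auto simp: C_def)
  ultimately show ?thesis
    by (simp add: c_def) (simp add: C_def)
qed

lemma eigen_frame_mat_1: "eigen_frame (mat 1) (mat 1) 0"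
proof -
  have "cis 0 *s v = v" for v :: "complex ^ 'n"
    by (simp add: vec_eq_iff)
  then show ?thesis
    by (simp add: eigen_frame_def)
qed

text \<open>The determinant fixes the phase sum modulo full turns, so
  \<open>2 * t * s - phase_sum (W t)\<close> is \<open>2 * pi\<close> times an integer
  \<open>g t\<close>. The semicontinuity of the phase sum supplies the local bounds that
  \<open>integer_drop_bound\<close> needs for \<open>g\<close>.\<close>

lemma symmetric_unitary_path_crossings:
  fixes W :: "real \<Rightarrow> complex ^ 'n ^ 'n" and d :: "real \<Rightarrow> nat"
  assumes W: "\<And>t. symmetric_unitary (W t)" and cont: "\<And>t. isCont W t"
    and W0: "W 0 = mat 1" and det: "\<And>t. det (W t) = cis (2 * t * s)"
    and d: "\<And>t. dim (fixed_space (W t)) \<le> d t"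
    and T: "0 \<le> T" and fin: "finite {t \<in> {0<..T}. d t \<noteq> 0}"
  shows "T * s / pi - real CARD('n) < (\<Sum>t | t \<in> {0<..T} \<and> d t \<noteq> 0. real (d t))"
proof -
  have "\<exists>k::int. 2 * t * s = phase_sum (W t) + 2 * pi * k" for t
  proof -
    obtain R \<theta> where "eigen_frame (W t) R \<theta>" "phase_sum (W t) = (\<Sum>k\<in>UNIV. \<theta> $ k)"
      using phase_sumE[OF W] by metis
    then have "cis (2 * t * s) = cis (phase_sum (W t))"
      using det[of t] det_eigen_frame[of "W t" R \<theta>] by simp
    then show ?thesis
      by (intro sin_cos_eq_iff[THEN iffD1]) (auto simp: complex_eq_iff)
  qed
  then obtain g :: "real \<Rightarrow> int" where g: "\<And>t. 2 * t * s = phase_sum (W t) + 2 * pi * g t"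
    by metis
  have "phase_sum (W 0) = 0"
    using phase_sum_eigen_frame[OF W[of 0], of "mat 1" 0] eigen_frame_mat_1 by (simp add: W0)
  then have "g 0 = 0"
    using g[of 0] by simp
  have "g T - g 0 \<le> (\<Sum>t | t \<in> {0<..T} \<and> d t \<noteq> 0. int (d t))"
  proof (rule integer_drop_bound[OF T fin])
    fix t0
    have "((\<lambda>t. 2 * t * s) \<longlongrightarrow> 2 * t0 * s) (nhds t0)"
      by (intro tendsto_intros filterlim_ident)
    \<comment> \<open>With margins \<open>pi / 2\<close> for the linear term and for the phase sum
      the total error stays below one turn. Integrality of \<open>g\<close> then sharpens the strict
      estimates with one extra turn to the exact ones.\<close>
    then have "eventually (\<lambda>t. 2 * t * s \<in> ball (2 * t0 * s) (pi / 2)) (nhds t0)"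
      by (rule topological_tendstoD) auto
    moreover have "eventually (\<lambda>t. phase_sum (W t0) - pi / 2 < phase_sum (W t) \<and>
        phase_sum (W t) < phase_sum (W t0) + 2 * pi * dim (fixed_space (W t0)) + pi / 2) (nhds t0)"
      by (rule eventually_phase_sum[OF W cont]) simp
    ultimately show "eventually (\<lambda>t. g t0 - int (d t0) \<le> g t \<and> g t \<le> g t0) (nhds t0)"
    proof eventually_elim
      case (elim t)
      have "2 * pi * dim (fixed_space (W t0)) \<le> 2 * pi * d t0"
        using d by simp
      moreover have "\<bar>2 * t0 * s - 2 * t * s\<bar> < pi / 2"
        using elim(1) by (simp only: mem_ball dist_real_def)
      ultimately have "2 * pi * g t0 - 2 * pi * d t0 - 2 * pi < 2 * pi * g t"
        "2 * pi * g t < 2 * pi * g t0 + 2 * pi"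
        using elim(2) g[of t] g[of t0] pi_gt_zero unfolding abs_less_iff by linarith+
      then have "2 * pi * (real_of_int (g t0 - int (d t0) - 1)) < 2 * pi * g t"
        "2 * pi * g t < 2 * pi * (real_of_int (g t0 + 1))"
        by (simp_all add: algebra_simps)
      then have "g t0 - int (d t0) - 1 < g t" "g t < g t0 + 1"
        by (simp_all only: mult_less_cancel_left_pos[OF pi_gt_zero] mult.assoc mult_less_cancel_left
           of_int_less_iff) (use pi_gt_zero in auto)
      then show ?case by simp
    qed
  qed
  then have "real_of_int (g T) \<le> real_of_int (\<Sum>t | t \<in> {0<..T} \<and> d t \<noteq> 0. int (d t))"
    using \<open>g 0 = 0\<close> by (simp only: of_int_le_iff diff_zero)
  then have "real_of_int (g T) \<le> (\<Sum>t | t \<in> {0<..T} \<and> d t \<noteq> 0. real (d t))"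
    by simp
  moreover have "T * s / pi - real CARD('n) < g T"
  proof -
    obtain \<theta> :: "real ^ 'n" where \<theta>: "\<And>k. \<theta> $ k < 2 * pi" "phase_sum (W T) = (\<Sum>k\<in>UNIV. \<theta> $ k)"
      using phase_sumE[OF W] by metis
    \<comment> \<open>Each of the \<open>CARD('n)\<close> phases is strictly below
      \<open>2 * pi\<close>; this accounts for the subtracted \<open>CARD('n)\<close> and for the
      strict inequality.\<close>
    have "phase_sum (W T) < (\<Sum>k\<in>(UNIV :: 'n set). 2 * pi)"
      unfolding \<theta>(2) by (intro sum_strict_mono) (auto simp: \<theta>)
    then have "T * s < pi * (g T + real CARD('n))"
      using g[of T] by (simp add: algebra_simps)
    then show ?thesis
      by (simp add: field_simps)
  qed
  ultimately show ?thesis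
    by linarith
qed

section \<open>Relative position of a rotated Lagrangian subspace\<close>

definition cadj :: "complex ^ 'm ^ 'n \<Rightarrow> complex ^ 'n ^ 'm" where
  "cadj A = (\<chi> i j. cnj (A $ j $ i))"

lemma cadj_mul: "cadj (A ** B) = cadj B ** cadj A"
  by (simp add: cadj_def matrix_matrix_mult_def vec_eq_iff mult.commute)

lemma cadj_transpose: "cadj (transpose A) = transpose (cadj A)"
  by (simp add: cadj_def transpose_def)

lemma cadj_cadj [simp]: "cadj (cadj A) = A"
  by (simp add: cadj_def vec_eq_iff)

text \<open>In the coordinates \<open>x + \<i> p\<close> this is the flow for time
  \<open>- t\<close>, which carries the Lagrangian subspace to the Jacobi curve at \<open>t\<close>.
  The variant \<open>rot_matrix\<close> serves for products and determinants.\<close>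

definition rot :: "('n \<Rightarrow> real) \<Rightarrow> real \<Rightarrow> complex ^ 'n \<Rightarrow> complex ^ 'n" where
  "rot w t v = (\<chi> j. cis (t * w j) * v $ j)"

definition rot_matrix :: "('n \<Rightarrow> real) \<Rightarrow> real \<Rightarrow> complex ^ 'n ^ 'n" where
  "rot_matrix w t = (\<chi> i j. if i = j then cis (t * w j) else 0)"

lemma rot_matrix_mult: "rot_matrix w t *v v = rot w t v"
  by (simp add: rot_matrix_def rot_def matrix_vector_mult_def vec_eq_iff if_distrib[of "\<lambda>a. a * _"] cong: if_cong)

lemma cadj_rot_matrix: "cadj (rot_matrix w t) ** rot_matrix w t = mat 1"
  by (simp add: rot_matrix_def cadj_def matrix_matrix_mult_def vec_eq_iff mat_def if_distrib[of cnj]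
      if_distrib[of "\<lambda>a. a * _"] cis_cnj cis_mult cong: if_cong)

lemma det_rot_matrix: "det (rot_matrix w t) = cis (t * (\<Sum>j\<in>UNIV. w j))"
  unfolding rot_matrix_def by (subst det_diagonal) (auto simp: cis_sum sum_distrib_left)

lemma linear_cvec: "linear cvec"
  by (rule linearI) (auto simp: vec_eq_iff scaleR_conv_of_real[where 'a = complex])

section \<open>The flow in a unitary frame and its eigenvalue 1\<close>

context
  fixes U :: "complex ^ 'n ^ 'n" and w :: "'n \<Rightarrow> real"
  assumes U: "cadj U ** U = mat 1"
begin

text \<open>The rotation in the frame of the columns of \<open>U\<close>. In the application their
  real span is the Lagrangian subspace, which thus consists of the real vectors of this
  frame.\<close>

definition relative :: "real \<Rightarrow> complex ^ 'n ^ 'n" where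
  "relative t = cadj U ** rot_matrix w t ** U"

text \<open>Souriau's matrix of the pair of Lagrangian subspaces \<open>D(t) V\<close>, \<open>V\<close>.\<close>

definition souriau :: "real \<Rightarrow> complex ^ 'n ^ 'n" where
  "souriau t = transpose (relative t) ** relative t"

lemma U_cadj: "U ** cadj U = mat 1"
  using U by (rule matrix_left_right_inverse1)

lemma relative_unitary: "cadj (relative t) ** relative t = mat 1" "relative t ** cadj (relative t) = mat 1"
proof -
  have "cadj (relative t) ** relative t =
      cadj U ** (cadj (rot_matrix w t) ** ((U ** cadj U) ** rot_matrix w t)) ** U"
    by (simp add: relative_def cadj_mul matrix_mul_assoc)
  also have "\<dots> = mat 1"
    by (simp add: U_cadj cadj_rot_matrix U)
  finally show "cadj (relative t) ** relative t = mat 1" .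
  then show "relative t ** cadj (relative t) = mat 1"
    by (rule matrix_left_right_inverse1)
qed

text \<open>Unitarity transposed: the left factor is the entrywise conjugate of
  \<open>relative t\<close>.\<close>

lemma cnj_relative: "transpose (cadj (relative t)) ** transpose (relative t) = mat 1"
  by (simp add: relative_unitary transpose_mat flip: matrix_transpose_mul)

lemma symmetric_unitary_souriau: "symmetric_unitary (souriau t)"
proof -
  have sym: "transpose (souriau t) = souriau t"
    by (simp add: souriau_def matrix_transpose_mul)
  have "(\<chi> i j. cnj (souriau t $ i $ j)) = cadj (transpose (souriau t))"
    by (simp add: cadj_def transpose_def)
  also have "\<dots> = cadj (souriau t)"
    by (simp only: sym)
  also have "\<dots> ** souriau t = cadj (relative t) **
      (transpose (cadj (relative t)) ** transpose (relative t)) ** relative t"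
    by (simp add: souriau_def cadj_mul cadj_transpose matrix_mul_assoc)
  also have "\<dots> = mat 1"
    by (simp add: cnj_relative relative_unitary)
  finally show ?thesis
    using sym by (simp add: symmetric_unitary_def)
qed

text \<open>The determinants of \<open>U\<close> and \<open>cadj U\<close> cancel, and the
  transposed factor has the same determinant as \<open>relative t\<close>, which doubles the
  phase.\<close>

lemma det_souriau: "det (souriau t) = cis (2 * t * (\<Sum>j\<in>UNIV. w j))"
proof -
  have "det (cadj U) * det U = 1"
    using det_mul[of "cadj U" U] by (simp add: U)
  then have "det (relative t) = cis (t * (\<Sum>j\<in>UNIV. w j))"
    by (simp add: relative_def det_mul det_rot_matrix algebra_simps)
  then show ?thesis
    by (simp add: souriau_def det_mul cis_mult mult.assoc)
qed

lemma souriau_0: "souriau 0 = mat 1"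
proof -
  have "rot_matrix w 0 = mat 1"
    by (simp add: rot_matrix_def mat_def vec_eq_iff)
  then show ?thesis
    by (simp add: souriau_def relative_def U transpose_mat)
qed

lemma isCont_souriau: "isCont souriau t"
proof -
  have rot: "isCont (\<lambda>t. rot_matrix w t $ i $ j) t" for i j
    by (cases "i = j") (auto simp: rot_matrix_def cis_conv_exp intro!: continuous_intros)
  have rel: "isCont (\<lambda>t. relative t $ i $ j) t" for i j
    unfolding relative_def matrix_matrix_mult_def by (simp, intro continuous_intros rot)
  have "isCont (\<lambda>t. souriau t $ i $ j) t" for i j
    unfolding souriau_def matrix_matrix_mult_def transpose_def by (simp, intro continuous_intros rel)
  then show ?thesis
    unfolding isCont_def by (intro vec_tendstoI)
qed

text \<open>The inverse of \<open>M\<^sup>T\<close> is the conjugate of \<open>M\<close>, so \<open>M\<^sup>T M r = r\<close> says that \<open>M r\<close> is its own conjugate.\<close>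

lemma rot_fixed_space:
  assumes "r \<in> fixed_space (souriau t)"
  obtains s where "rot w t (U *v cvec r) = U *v cvec s"
proof -
  let ?M = "relative t"
  have r: "souriau t *v cvec r = cvec r"
    using assms by (simp add: fixed_space_def)
  have "?M *v cvec r = (transpose (cadj ?M) ** transpose ?M) *v (?M *v cvec r)"
    by (simp add: cnj_relative)
  also have "\<dots> = transpose (cadj ?M) *v (souriau t *v cvec r)"
    by (simp add: souriau_def matrix_vector_mul_assoc matrix_mul_assoc)
  also have "\<dots> = transpose (cadj ?M) *v cvec r"
    by (simp only: r)
  finally have *: "?M *v cvec r = transpose (cadj ?M) *v cvec r" .
  have "(?M *v cvec r) $ i = cnj ((?M *v cvec r) $ i)" for i
    by (subst *) (simp add: matrix_vector_mult_def transpose_def cadj_def)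
  then have "?M *v cvec r = cvec (\<chi> i. Re ((?M *v cvec r) $ i))"
    by (simp add: vec_eq_iff complex_eq_iff)
  then obtain s where s: "?M *v cvec r = cvec s"
    by blast
  \<comment> \<open>Applying \<open>U\<close> to \<open>M r = s\<close> undoes the change of frame,
    because \<open>U ** cadj U = mat 1\<close>.\<close>
  have "U *v cvec s = (U ** cadj U) *v (rot_matrix w t *v (U *v cvec r))"
    by (simp add: relative_def matrix_vector_mul_assoc matrix_mul_assoc flip: s)
  then show ?thesis
    using that[of s] by (simp add: U_cadj rot_matrix_mult)
qed

lemma inj_frame_map: "inj (\<lambda>r. U *v cvec r)"
proof (rule injI)
  fix r s assume "U *v cvec r = U *v cvec s"
  then have "cadj U *v (U *v cvec r) = cadj U *v (U *v cvec s)"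
    by simp
  then show "r = s"
    by (simp add: matrix_vector_mul_assoc U vec_eq_iff)
qed

end

lemma inj_rot: "inj (rot w t)"
  by (rule injI) (simp add: rot_def vec_eq_iff)

lemma linear_rot: "linear (rot w t)"
  by (rule linearI) (auto simp: rot_def vec_eq_iff algebra_simps)

section \<open>Transport to complex coordinates\<close>

text \<open>With \<open>x\<close> as real and \<open>p\<close> as imaginary part, the symplectic
  form becomes the imaginary part of the standard Hermitian product and the flow becomes
  diagonal.\<close>

definition complex_coord :: "('a \<Rightarrow> real ^ 'n) \<Rightarrow> ('a \<Rightarrow> real ^ 'n) \<Rightarrow> 'a \<Rightarrow> complex ^ 'n" where
  "complex_coord p x z = (\<chi> j. Complex (x z $ j) (p z $ j))"

context
  fixes \<sigma> :: "'a::euclidean_space \<Rightarrow> 'a \<Rightarrow> real" and p x :: "'a \<Rightarrow> real ^ 'n"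
  assumes darboux: "darboux_coordinates \<sigma> p x"
begin

abbreviation (input) "\<zeta> \<equiv> complex_coord p x"

lemma darboux_linear: "linear p" "linear x"
  and darboux_bij: "bij (\<lambda>z. (p z, x z))"
  and darboux_form: "\<sigma> u v = (\<Sum>i\<in>UNIV. p u $ i * x v $ i - p v $ i * x u $ i)"
  using darboux by (auto simp: darboux_coordinates_def)

lemma linear_complex_coord: "linear \<zeta>"
  by (rule linearI)
    (simp_all add: complex_coord_def vec_eq_iff complex_eq_iff linear_add[OF darboux_linear(1)]
      linear_add[OF darboux_linear(2)] linear_scale[OF darboux_linear(1)] linear_scale[OF darboux_linear(2)])

lemma bij_complex_coord: "bij \<zeta>"
proof (rule bijI)
  show "inj \<zeta>"
  proof (rule injI)
    fix u v assume "\<zeta> u = \<zeta> v"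
    then have "(p u, x u) = (p v, x v)"
      by (simp add: complex_coord_def vec_eq_iff complex_eq_iff)
    then show "u = v"
      using bij_is_inj[OF darboux_bij] by (metis (no_types, lifting) injD)
  qed
  show "surj \<zeta>"
  proof (rule surjI)
    fix c :: "complex ^ 'n"
    let ?y = "(\<chi> j. Im (c $ j), \<chi> j. Re (c $ j))"
    have "(\<lambda>z. (p z, x z)) (inv (\<lambda>z. (p z, x z)) ?y) = ?y"
      by (rule surj_f_inv_f[OF bij_is_surj[OF darboux_bij]])
    then show "\<zeta> (inv (\<lambda>z. (p z, x z)) (\<chi> j. Im (c $ j), \<chi> j. Re (c $ j))) = c"
      by (simp add: complex_coord_def vec_eq_iff complex_eq_iff)
  qed
qed

lemma complex_coord_inv [simp]: "\<zeta> (inv \<zeta> c) = c" "inv \<zeta> (\<zeta> z) = z"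
  using bij_complex_coord by (auto simp: bij_is_surj surj_f_inv_f bij_is_inj)

lemma linear_inv_complex_coord: "linear (inv \<zeta>)"
proof (rule linearI)
  show "inv \<zeta> (a + b) = inv \<zeta> a + inv \<zeta> b" for a b
    using complex_coord_inv(2)[of "inv \<zeta> a + inv \<zeta> b"] by (simp add: linear_add[OF linear_complex_coord])
  show "inv \<zeta> (r *\<^sub>R a) = r *\<^sub>R inv \<zeta> a" for r a
    using complex_coord_inv(2)[of "r *\<^sub>R inv \<zeta> a"] by (simp add: linear_scale[OF linear_complex_coord])
qed

lemma form_complex_coord: "\<sigma> u v = Im (\<Sum>j\<in>UNIV. \<zeta> u $ j * cnj (\<zeta> v $ j))"
  by (simp add: darboux_form complex_coord_def mult.commute)

text \<open>Pairing with the vectors whose only nonzero coordinate is 1 or \<open>\<i>\<close>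
  determines the imaginary and the real part of every coordinate. This yields uniqueness of the
  Hamiltonian field.\<close>

lemma form_nondegenerate:
  assumes "\<And>v. \<sigma> v a = \<sigma> v b"
  shows "a = b"
proof -
  have "\<zeta> a $ j = \<zeta> b $ j" for j
  proof -
    have "Im (cnj c * \<zeta> a $ j) = Im (cnj c * \<zeta> b $ j)" for c
    proof -
      have "\<sigma> (inv \<zeta> (axis j c)) z = Im (c * cnj (\<zeta> z $ j))" for z
        by (simp add: form_complex_coord axis_def if_distrib[of "\<lambda>a. a * _"] cong: if_cong)
      then show ?thesis
        using assms[of "inv \<zeta> (axis j c)"] by simp
    qed
    from this[of 1] this[of \<i>] show ?thesis
      by (simp add: complex_eq_iff)
  qed
  then have "\<zeta> a = \<zeta> b"
    by (simp add: vec_eq_iff)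
  then show ?thesis
    by (metis complex_coord_inv(2))
qed

section \<open>The flow of a diagonal Hamiltonian\<close>

context
  fixes H :: "'a \<Rightarrow> real" and w :: "'n \<Rightarrow> real"
  assumes H: "\<And>z. H z = 1 / 2 * (\<Sum>j\<in>UNIV. w j * ((p z $ j)\<^sup>2 + (x z $ j)\<^sup>2))"
begin

text \<open>Hamilton's equations \<open>x' = w p\<close>, \<open>p' = - w x\<close> combine to a
  multiplication by \<open>- \<i> w\<close> in each coordinate. Differentiating \<open>H\<close>
  confirms this field, and nondegeneracy makes it the only one, so the description operator selects
  it.\<close>

lemma hamiltonian_field_complex_coord:
  "\<zeta> (hamiltonian_field \<sigma> H z) $ j = - \<i> * w j * \<zeta> z $ j"
proof -
  define X where "X z = inv \<zeta> (\<chi> j. - \<i> * w j * \<zeta> z $ j)" for z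
  have \<zeta>X: "\<zeta> (X z) $ j = - \<i> * w j * \<zeta> z $ j" for z j
    by (simp add: X_def)
  have form: "\<sigma> v (X z) = (\<Sum>j\<in>UNIV. w j * (p z $ j * p v $ j + x z $ j * x v $ j))" for v z
    unfolding form_complex_coord \<zeta>X by (simp add: complex_coord_def algebra_simps)
  have "(p has_derivative p) (at z)" "(x has_derivative x) (at z)" for z
    using darboux_linear by (auto intro: bounded_linear_imp_has_derivative simp: linear_conv_bounded_linear)
  then have "((\<lambda>z. p z $ j) has_derivative (\<lambda>v. p v $ j)) (at z)"
    "((\<lambda>z. x z $ j) has_derivative (\<lambda>v. x v $ j)) (at z)" for z j
    by (auto intro: bounded_linear.has_derivative[OF bounded_linear_vec_nth])
  then have "((\<lambda>z. 1 / 2 * (\<Sum>j\<in>UNIV. w j * ((p z $ j)\<^sup>2 + (x z $ j)\<^sup>2))) has_derivative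
      (\<lambda>v. 1 / 2 * (\<Sum>j\<in>UNIV. w j * (2 * (p z $ j * p v $ j) + 2 * (x z $ j * x v $ j))))) (at z)" for z
    unfolding power2_eq_square by (auto intro!: derivative_eq_intros simp: algebra_simps)
  moreover have "(\<lambda>v. 1 / 2 * (\<Sum>j\<in>UNIV. w j * (2 * (p z $ j * p v $ j) + 2 * (x z $ j * x v $ j))))
      = (\<lambda>v. \<sigma> v (X z))" for z
    by (simp add: form sum_distrib_left algebra_simps)
  ultimately have "(H has_derivative (\<lambda>v. \<sigma> v (X z))) (at z)" for z
    unfolding H[abs_def] by simp
  note der = this
  have "hamiltonian_field \<sigma> H = X"
    unfolding hamiltonian_field_def
  proof (rule the_equality)
    show "\<forall>z. (H has_derivative (\<lambda>v. \<sigma> v (X z))) (at z)"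
      using der by (rule allI)
  next
    fix Y assume Y: "\<forall>z. (H has_derivative (\<lambda>v. \<sigma> v (Y z))) (at z)"
    show "Y = X"
    proof
      fix z
      have eq: "(\<lambda>v. \<sigma> v (Y z)) = (\<lambda>v. \<sigma> v (X z))"
        by (rule has_derivative_unique[OF spec[OF Y] der])
      show "Y z = X z"
        by (rule form_nondegenerate) (rule fun_cong[OF eq])
    qed
  qed
  then show ?thesis
    by (simp add: \<zeta>X)
qed

text \<open>In each complex coordinate the series is the scalar exponential series of
  \<open>\<i> * t * w j\<close>, the sign of the field cancelling that of \<open>- t\<close>. The
  limit is transported back by the continuous linear map \<open>inv \<zeta>\<close>.\<close>

lemma lin_exp_complex_coord:
  "lin_exp (\<lambda>z. (- t) *\<^sub>R hamiltonian_field \<sigma> H z) v = inv \<zeta> (rot w t (\<zeta> v))"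
proof -
  let ?L = "\<lambda>z. (- t) *\<^sub>R hamiltonian_field \<sigma> H z"
  have L: "\<zeta> (?L z) $ j = (\<i> * of_real (t * w j)) * \<zeta> z $ j" for z j
    using hamiltonian_field_complex_coord[of z j]
    by (simp add: linear_scale[OF linear_complex_coord] scaleR_conv_of_real[where 'a = complex] del: scaleR_minus_left)
  have pow: "\<zeta> ((?L ^^ k) v) $ j = (\<i> * of_real (t * w j)) ^ k * \<zeta> v $ j" for k j
    by (induction k) (simp_all add: L del: scaleR_minus_left)
  have "(\<lambda>k. \<zeta> ((?L ^^ k) v /\<^sub>R fact k) $ j) sums (rot w t (\<zeta> v) $ j)" for j
  proof -
    have "(\<lambda>k. (\<i> * of_real (t * w j)) ^ k /\<^sub>R fact k * \<zeta> v $ j) sums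
        (exp (\<i> * of_real (t * w j)) * \<zeta> v $ j)"
      by (intro sums_mult2 exp_converges)
    then show ?thesis
      by (simp add: linear_scale[OF linear_complex_coord] pow rot_def cis_conv_exp del: scaleR_minus_left)
  qed
  then have "(\<lambda>k. \<zeta> ((?L ^^ k) v /\<^sub>R fact k)) sums rot w t (\<zeta> v)"
    unfolding sums_def by (intro vec_tendstoI) simp
  then have "(\<lambda>k. inv \<zeta> (\<zeta> ((?L ^^ k) v /\<^sub>R fact k))) sums inv \<zeta> (rot w t (\<zeta> v))"
    by (rule bounded_linear.sums[OF linear_inv_complex_coord[unfolded linear_conv_bounded_linear]])
  then show ?thesis
    unfolding lin_exp_def by (simp add: sums_iff del: scaleR_minus_left)
qed

lemma jacobi_curve_complex_coord:
  "jacobi_curve \<sigma> H V t = (\<lambda>v. inv \<zeta> (rot w t (\<zeta> v))) ` V"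
  unfolding jacobi_curve_def lin_exp_complex_coord ..

text \<open>A fixed vector \<open>r\<close> goes to the rotated image of \<open>U r\<close>. This
  lies on the Jacobi curve because \<open>U r\<close> represents a point of \<open>V\<close>, and in
  \<open>V\<close> because by \<open>rot_fixed_space\<close> it equals some \<open>U s\<close> with
  \<open>s\<close> real. The map is linear and injective.\<close>

lemma dim_fixed_space_le:
  fixes U :: "complex ^ 'n ^ 'n"
  assumes U: "cadj U ** U = mat 1" and V: "\<And>r. inv \<zeta> (U *v cvec r) \<in> V"
  shows "dim (fixed_space (souriau U w t)) \<le> conjugate_multiplicity \<sigma> H V t"
proof -
  let ?F = "fixed_space (souriau U w t)"
  let ?f = "\<lambda>r. inv \<zeta> (rot w t (U *v cvec r))"
  have lin: "linear ?f"
    using linear_compose[OF linear_compose[OF linear_compose[OF linear_cvec matrix_vector_mul_linear[of U]] linear_rot[of w t]] linear_inv_complex_coord]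
    by (simp add: o_def)
  have "inj ?f"
    using inj_compose[OF bij_is_inj[OF bij_imp_bij_inv[OF bij_complex_coord]]
        inj_compose[OF inj_rot[of w t] inj_frame_map[OF U]]]
    by (simp add: o_def)
  then have "dim (?f ` ?F) = dim ?F"
    using lin by (intro dim_image_eq) (auto intro: inj_on_subset)
  moreover have "?f ` ?F \<subseteq> jacobi_curve \<sigma> H V t \<inter> V"
  proof (intro subsetI IntI)
    fix y assume "y \<in> ?f ` ?F"
    then obtain r where r: "r \<in> ?F" "y = ?f r" by blast
    obtain s where "rot w t (U *v cvec r) = U *v cvec s"
      using rot_fixed_space[OF U r(1)] by blast
    with V r show "y \<in> V" by simp
    have "y = inv \<zeta> (rot w t (\<zeta> (inv \<zeta> (U *v cvec r))))"
      using r by simp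
    then show "y \<in> jacobi_curve \<sigma> H V t"
      unfolding jacobi_curve_complex_coord using V by blast
  qed
  ultimately show ?thesis
    unfolding conjugate_multiplicity_def by (metis dim_subset)
qed

text \<open>The intersection is a subspace and so contains 0; differing from \<open>{0}\<close>
  therefore means positive dimension and never emptiness.\<close>

lemma conjugate_time_iff:
  assumes V: "subspace V"
  shows "conjugate_time \<sigma> H V t \<longleftrightarrow> t \<noteq> 0 \<and> conjugate_multiplicity \<sigma> H V t \<noteq> 0"
proof -
  have "linear (\<lambda>v. inv \<zeta> (rot w t (\<zeta> v)))"
    using linear_compose[OF linear_compose[OF linear_complex_coord linear_rot[of w t]] linear_inv_complex_coord]
    by (simp add: o_def)
  then have "subspace (jacobi_curve \<sigma> H V t \<inter> V)"
    unfolding jacobi_curve_complex_coord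
    using V by (intro subspace_inter linear_subspace_image)
  then have "0 \<in> jacobi_curve \<sigma> H V t \<inter> V"
    by (rule subspace_0)
  then show ?thesis
    unfolding conjugate_time_def conjugate_multiplicity_def dim_eq_0 by blast
qed

end

text \<open>Take a basis of the image of \<open>V\<close> that is orthonormal for the real inner
  product, the real part of the Hermitian product. The imaginary part is the symplectic form, which
  vanishes on \<open>V\<close>, so the basis is Hermitian orthonormal and its
  \<open>CARD('n)\<close> vectors are the columns of a unitary matrix.\<close>

lemma ex_unitary_frame:
  fixes V :: "'a set"
  assumes V: "subspace V" "dim V = CARD('n)" and iso: "\<And>u v. u \<in> V \<Longrightarrow> v \<in> V \<Longrightarrow> \<sigma> u v = 0"
  obtains U :: "complex ^ 'n ^ 'n" where "cadj U ** U = mat 1" "(\<lambda>r. inv \<zeta> (U *v cvec r)) ` UNIV \<subseteq> V"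
    "V \<subseteq> span (range (\<lambda>k. inv \<zeta> (column k U)))"
proof -
  have sub: "subspace (\<zeta> ` V)"
    using linear_complex_coord V(1) by (rule linear_subspace_image)
  have "dim (\<zeta> ` V) = CARD('n)"
    using V(2) dim_image_eq[OF linear_complex_coord inj_on_subset[OF bij_is_inj[OF bij_complex_coord]]]
    by simp
  then obtain B where B: "B \<subseteq> \<zeta> ` V" "pairwise orthogonal B" "\<And>b. b \<in> B \<Longrightarrow> norm b = 1"
    "independent B" "card B = CARD('n)" "span B = \<zeta> ` V"
    using orthonormal_basis_subspace[OF sub] by metis
  then obtain u :: "'n \<Rightarrow> complex ^ 'n" where u: "bij_betw u UNIV B"
    using finite_same_card_bij[of "UNIV :: 'n set" B] independent_imp_finite[OF B(4)] by auto
  then have uB: "u k \<in> B" and ran: "range u = B" for k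
    by (auto simp: bij_betw_def)
  define U :: "complex ^ 'n ^ 'n" where "U = (\<chi> j k. u k $ j)"
  have col: "column k U = u k" for k
    by (simp add: U_def column_def vec_eq_iff)
  have "(\<Sum>j\<in>UNIV. cnj (u k $ j) * u l $ j) = (if k = l then 1 else 0)" for k l
  proof (rule complex_eqI)
    have "u k \<bullet> u l = (if k = l then 1 else 0)"
    proof (cases "k = l")
      case True
      then show ?thesis using B(3)[OF uB] by (simp add: dot_square_norm)
    next
      case False
      then have "u k \<noteq> u l"
        using u by (auto simp: bij_betw_def inj_on_def)
      with False B(2) uB show ?thesis
        by (simp add: pairwise_def orthogonal_def)
    qed
    then show "Re (\<Sum>j\<in>UNIV. cnj (u k $ j) * u l $ j) = Re (if k = l then 1 else 0)"
      by (simp add: inner_vec_def inner_complex_def)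
    obtain a b where "a \<in> V" "b \<in> V" "u k = \<zeta> b" "u l = \<zeta> a"
      using B(1) uB by blast
    then show "Im (\<Sum>j\<in>UNIV. cnj (u k $ j) * u l $ j) = Im (if k = l then 1 else 0)"
      using iso[of a b] by (simp add: form_complex_coord mult.commute)
  qed
  then have 1: "cadj U ** U = mat 1"
    by (simp add: cadj_def U_def matrix_matrix_mult_def mat_def vec_eq_iff)
  have 2: "(\<lambda>r. inv \<zeta> (U *v cvec r)) ` UNIV \<subseteq> V"
  proof clarify
    fix r :: "real ^ 'n"
    have "U *v cvec r = (\<Sum>k\<in>UNIV. r $ k *\<^sub>R u k)"
      by (simp add: U_def matrix_vector_mult_def vec_eq_iff sum_component scaleR_conv_of_real[where 'a = complex] mult.commute)
    also have "\<dots> \<in> \<zeta> ` V"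
      unfolding B(6)[symmetric] by (intro span_sum span_scale span_base uB)
    finally show "inv \<zeta> (U *v cvec r) \<in> V"
      by auto
  qed
  have "V = inv \<zeta> ` span B"
    unfolding B(6) by (simp add: image_image)
  also have "\<dots> = span (inv \<zeta> ` B)"
    by (rule linear_span_image[OF linear_inv_complex_coord, symmetric])
  also have "inv \<zeta> ` B = range (\<lambda>k. inv \<zeta> (column k U))"
    unfolding col ran[symmetric] by auto
  finally show ?thesis
    by (intro that[OF 1 2]) (rule equalityD1)
qed

end

section \<open>Positivity and counting\<close>

text \<open>Both sides are the trace of the diagonal matrix of the weights, on the left computed in
  the unitary frame \<open>U\<close>; it rests on the rows of \<open>U\<close> being unit
  vectors.\<close>

lemma trace_frame:
  fixes U :: "complex ^ 'n ^ 'n" and w :: "'n \<Rightarrow> real"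
  assumes "cadj U ** U = mat 1"
  shows "(\<Sum>k\<in>UNIV. \<Sum>j\<in>UNIV. w j * (norm (U $ j $ k))\<^sup>2) = (\<Sum>j\<in>UNIV. w j)"
proof -
  have "U ** cadj U = mat 1"
    using assms by (rule matrix_left_right_inverse1)
  then have "(\<Sum>k\<in>UNIV. U $ j $ k * cnj (U $ j $ k)) = 1" for j
    by (simp add: vec_eq_iff matrix_matrix_mult_def cadj_def mat_def)
  then have "complex_of_real (\<Sum>k\<in>UNIV. (norm (U $ j $ k))\<^sup>2) = 1" for j
    by (simp only: of_real_sum complex_norm_square)
  then have row: "(\<Sum>k\<in>UNIV. (norm (U $ j $ k))\<^sup>2) = 1" for j
    by (simp only: of_real_eq_1_iff)
  have "(\<Sum>k\<in>UNIV. \<Sum>j\<in>UNIV. w j * (norm (U $ j $ k))\<^sup>2) =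
      (\<Sum>j\<in>UNIV. \<Sum>k\<in>UNIV. w j * (norm (U $ j $ k))\<^sup>2)"
    by (rule sum.swap)
  also have "\<dots> = (\<Sum>j\<in>UNIV. w j)"
    by (simp add: row flip: sum_distrib_left)
  finally show ?thesis .
qed

text \<open>If \<open>B\<close> vanished, so would every block, and the rank would be 0, below the
  positive \<open>CARD('n)\<close>.\<close>

lemma kalman_rank_condition_nonzero:
  fixes B :: "real ^ 'k ^ 'n"
  assumes "kalman_rank_condition A B"
  shows "B \<noteq> 0"
proof
  assume "B = 0"
  have "A ** (0 :: real ^ 'k ^ 'n) = 0"
    by (simp add: vec_eq_iff matrix_matrix_mult_def)
  then have "((**) A ^^ i) B = 0" for i
    by (induction i) (simp_all add: \<open>B = 0\<close>)
  then have zero: "dim (\<Union>i<m. columns (((**) A ^^ i) B)) = 0" for m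
    by (auto simp: dim_eq_0 columns_def column_def vec_eq_iff)
  obtain m where m: "dim (\<Union>i<m. columns (((**) A ^^ i) B)) = CARD('n)"
    using assms by (auto simp: kalman_rank_condition_def)
  have "CARD('n) = 0"
    by (rule trans[OF m[symmetric] zero])
  then show False
    by simp
qed

text \<open>The chart witnessing controllability may differ from the one that diagonalizes
  \<open>H\<close>. On \<open>V\<close> its \<open>x\<close> coordinates vanish, and only the square
  of the norm of \<open>transpose B\<close> applied to the \<open>p\<close> coordinates remains,
  with \<open>C = transpose B\<close> nonzero.\<close>

lemma controllable_vertical:
  fixes \<sigma> :: "'a::euclidean_space \<Rightarrow> 'a \<Rightarrow> real"
  assumes "controllable TYPE('n::finite) TYPE('k::finite) \<sigma> H V"
  obtains q :: "'a \<Rightarrow> real ^ 'n" and C :: "real ^ 'n ^ 'k" where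
    "linear q" "inj_on q V" "q ` V = UNIV" "C \<noteq> 0"
    "\<And>z. z \<in> V \<Longrightarrow> H z = 1 / 2 * (norm (C *v q z))\<^sup>2"
proof -
  obtain q y :: "'a \<Rightarrow> real ^ 'n" and A :: "real ^ 'n ^ 'n" and B :: "real ^ 'k ^ 'n" and Q :: "real ^ 'n ^ 'n"
    where qy: "darboux_coordinates \<sigma> q y" and V: "V = {z. y z = 0}"
    and H: "\<forall>z. H z = 1 / 2 * (q z \<bullet> ((B ** transpose B) *v q z)
                            + 2 * (q z \<bullet> (A *v y z)) + y z \<bullet> (Q *v y z))"
    and B: "kalman_rank_condition A B"
    using assms unfolding controllable_def by blast
  have bij: "bij (\<lambda>z. (q z, y z))" and "linear q"
    using qy by (auto simp: darboux_coordinates_def)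
  have "inj_on q V"
    using injD[OF bij_is_inj[OF bij]] by (auto simp: inj_on_def V)
  moreover have "q ` V = UNIV"
  proof (intro set_eqI iffI UNIV_I)
    fix c
    obtain z where "(c, 0) = (q z, y z)"
      by (rule surjE[OF bij_is_surj[OF bij]])
    then show "c \<in> q ` V"
      by (auto simp: V)
  qed
  moreover have "transpose B \<noteq> 0"
    using kalman_rank_condition_nonzero[OF B] by (auto simp: vec_eq_iff transpose_def)
  moreover have "H z = 1 / 2 * (norm (transpose B *v q z))\<^sup>2" if "z \<in> V" for z
  proof -
    have "q z \<bullet> ((B ** transpose B) *v q z) = (transpose B *v q z) \<bullet> (transpose B *v q z)"
      using dot_lmul_matrix[of "q z" B "transpose B *v q z"]
      by (simp add: transpose_matrix_vector flip: matrix_vector_mul_assoc)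
    then show ?thesis
      using that H by (simp add: V dot_square_norm)
  qed
  ultimately show ?thesis
    using that \<open>linear q\<close> by blast
qed

text \<open>The values of \<open>2 * H\<close> on the frame vectors of \<open>V\<close> add up to
  the sum of the weights by \<open>trace_frame\<close>, and each is the square of a norm. If the sum
  were 0, then \<open>C\<close> composed with \<open>q\<close> would vanish on a spanning set of
  \<open>V\<close>, and \<open>C\<close> would be 0 as \<open>q\<close> maps \<open>V\<close> onto
  the whole space.\<close>

lemma sum_weights_pos:
  fixes \<sigma> :: "'a::euclidean_space \<Rightarrow> 'a \<Rightarrow> real" and p x :: "'a \<Rightarrow> real ^ 'n" and C :: "real ^ 'n ^ 'k"
    and U :: "complex ^ 'n ^ 'n" and w :: "'n \<Rightarrow> real"
  assumes darboux: "darboux_coordinates \<sigma> p x"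
    and H: "\<And>z. H z = 1 / 2 * (\<Sum>j\<in>UNIV. w j * ((p z $ j)\<^sup>2 + (x z $ j)\<^sup>2))"
    and U: "cadj U ** U = mat 1"
    and V: "\<And>k. inv (complex_coord p x) (column k U) \<in> V"
       "V \<subseteq> span (range (\<lambda>k. inv (complex_coord p x) (column k U)))"
    and q: "linear q" "q ` V = UNIV" and C: "C \<noteq> 0"
    and HV: "\<And>z. z \<in> V \<Longrightarrow> H z = 1 / 2 * (norm (C *v q z))\<^sup>2"
  shows "0 < (\<Sum>j\<in>UNIV. w j)"
proof -
  let ?z = "\<lambda>k. inv (complex_coord p x) (column k U)"
  have "2 * H (?z k) = (\<Sum>j\<in>UNIV. w j * (norm (U $ j $ k))\<^sup>2)" for k
  proof -
    have "U $ j $ k = complex_coord p x (?z k) $ j" for j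
      using complex_coord_inv(1)[OF darboux] by (simp add: column_def)
    then have "(norm (U $ j $ k))\<^sup>2 = (p (?z k) $ j)\<^sup>2 + (x (?z k) $ j)\<^sup>2" for j
      by (simp add: complex_coord_def cmod_power2)
    then show ?thesis by (simp add: H)
  qed
  then have *: "(\<Sum>j\<in>UNIV. w j) = (\<Sum>k\<in>UNIV. (norm (C *v q (?z k)))\<^sup>2)"
    using trace_frame[OF U, of w] HV[OF V(1)] by simp
  then have "0 \<le> (\<Sum>j\<in>UNIV. w j)"
    by (simp add: sum_nonneg)
  moreover have "(\<Sum>j\<in>UNIV. w j) \<noteq> 0"
  proof
    assume "(\<Sum>j\<in>UNIV. w j) = 0"
    then have zero: "C *v q (?z k) = 0" for k
      using * by (simp add: sum_nonneg_eq_0_iff)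
    have "linear (\<lambda>z. C *v q z)"
      using linear_compose[OF q(1) matrix_vector_mul_linear[of C]] by (simp add: o_def)
    then have "C *v q z = 0" if "z \<in> V" for z
      using linear_eq_0_on_span[of "\<lambda>z. C *v q z" "range ?z" z] zero V(2) that by blast
    then have "C *v y = 0 *v y" for y
      using q(2) by (metis imageE matrix_vector_mult_0 UNIV_I)
    then show False
      using C by (metis matrix_eq)
  qed
  ultimately show ?thesis by simp
qed

text \<open>Any \<open>N\<close> of the conjugate times form a competing finite subset, and each
  contributes at least 1.\<close>

lemma num_conjugate_times_infinite:
  assumes "infinite {t \<in> S. conjugate_time \<sigma> H V t}"
    and mult: "\<And>t. conjugate_time \<sigma> H V t \<Longrightarrow> conjugate_multiplicity \<sigma> H V t \<noteq> 0"
  shows "enat N \<le> num_conjugate_times \<sigma> H V S"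
proof -
  obtain F where F: "finite F" "card F = N" "F \<subseteq> {t \<in> S. conjugate_time \<sigma> H V t}"
    using infinite_arbitrarily_large[OF assms(1)] by blast
  have "enat N = (\<Sum>t\<in>F. enat 1)"
    using F by (simp add: of_nat_eq_enat flip: one_enat_def)
  also have "\<dots> \<le> (\<Sum>t\<in>F. enat (conjugate_multiplicity \<sigma> H V t))"
    using F mult by (intro sum_mono) (force simp: Suc_le_eq)
  also have "\<dots> \<le> num_conjugate_times \<sigma> H V S"
    unfolding num_conjugate_times_def using F by (intro SUP_upper) auto
  finally show ?thesis .
qed

text \<open>The whole set is finite and hence one of the subsets over which the supremum is
  taken.\<close>

lemma num_conjugate_times_finite:
  assumes "finite {t \<in> S. conjugate_time \<sigma> H V t}"
  shows "enat (\<Sum>t | t \<in> S \<and> conjugate_time \<sigma> H V t. conjugate_multiplicity \<sigma> H V t)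
    \<le> num_conjugate_times \<sigma> H V S"
proof -
  have "enat (sum f F) = (\<Sum>t\<in>F. enat (f t))" for f :: "real \<Rightarrow> nat" and F
    by (induction F rule: infinite_finite_induct) (auto simp: zero_enat_def plus_enat_simps(1)[symmetric] simp del: plus_enat_simps(1))
  then show ?thesis
    unfolding num_conjugate_times_def using assms by (simp only:) (rule SUP_upper, simp)
qed

lemma ex_conjugate_time:
  assumes "enat 1 \<le> num_conjugate_times \<sigma> H V S"
  shows "\<exists>t\<in>S. conjugate_time \<sigma> H V t"
proof (rule ccontr)
  assume "\<not> ?thesis"
  then have "{t \<in> S. conjugate_time \<sigma> H V t} = {}"
    by blast
  then have "{F. finite F \<and> F \<subseteq> {t \<in> S. conjugate_time \<sigma> H V t}} = {{}}"
    by auto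
  then have "num_conjugate_times \<sigma> H V S = 0"
    unfolding num_conjugate_times_def by simp
  with assms show False
    by (simp add: zero_enat_def)
qed

theorem corollary3p11:
  fixes \<sigma> :: "'a::euclidean_space \<Rightarrow> 'a \<Rightarrow> real"
    and H :: "'a \<Rightarrow> real"
    and V :: "'a set"
    and p x :: "'a \<Rightarrow> real ^ 'n"
    and w :: "'n \<Rightarrow> real"
  assumes "LQ_problem \<sigma> H V"
    and "controllable TYPE('n) TYPE('k::finite) \<sigma> H V"
    and "darboux_coordinates \<sigma> p x"
    and "\<And>j. w j \<noteq> 0"
    and "\<And>z. H z = 1 / 2 * (\<Sum>j\<in>UNIV. w j * ((p z $ j)\<^sup>2 + (x z $ j)\<^sup>2))"
  shows "(\<forall>(N::nat) (T::real).
            N \<ge> 1 \<and> T \<ge> (real N + 3 * real CARD('n) - 1) * pi / (\<Sum>j\<in>UNIV. w j)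
              \<longrightarrow> enat N \<le> num_conjugate_times \<sigma> H V {0<..T}) \<and>
         first_conjugate_time \<sigma> H V \<le> ereal (3 * real CARD('n) * pi / (\<Sum>j\<in>UNIV. w j))"
proof -
  note darboux = assms(3) and H = assms(5)
  have lag: "lagrangian \<sigma> V"
    using assms(1) by (simp add: LQ_problem_def)
  then have V: "subspace V" and iso: "\<And>u v. u \<in> V \<Longrightarrow> v \<in> V \<Longrightarrow> \<sigma> u v = 0"
    unfolding lagrangian_def by blast+
  obtain q :: "'a \<Rightarrow> real ^ 'n" and C :: "real ^ 'n ^ 'k" where
    q: "linear q" "inj_on q V" "q ` V = UNIV" and C: "C \<noteq> 0"
    and HV: "\<And>z. z \<in> V \<Longrightarrow> H z = 1 / 2 * (norm (C *v q z))\<^sup>2"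
    using controllable_vertical[OF assms(2)] by metis
  have "dim V = dim (q ` V)"
    using q V by (subst dim_image_eq) (auto simp: span_eq_iff[THEN iffD2])
  then have "dim V = CARD('n)"
    using q by simp
  then obtain U :: "complex ^ 'n ^ 'n" where U: "cadj U ** U = mat 1"
    and range: "(\<lambda>r. inv (complex_coord p x) (U *v cvec r)) ` UNIV \<subseteq> V"
    and spn: "V \<subseteq> span (range (\<lambda>k. inv (complex_coord p x) (column k U)))"
    using ex_unitary_frame[OF darboux V _ iso] by metis
  have "U *v cvec (axis k 1) = column k U" for k
    by (simp add: vec_eq_iff matrix_vector_mult_def column_def axis_def if_distrib[of "\<lambda>a. _ * of_real a"] cong: if_cong)
  then have "inv (complex_coord p x) (column k U) \<in> V" for k
    using range by (metis UNIV_I image_subset_iff)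
  then have pos: "0 < (\<Sum>j\<in>UNIV. w j)"
    using spn q C HV by (intro sum_weights_pos[OF darboux H U, of V q C])
  let ?s = "\<Sum>j\<in>UNIV. w j" and ?n = "real CARD('n)"
  have conj: "conjugate_time \<sigma> H V t \<longleftrightarrow> t \<noteq> 0 \<and> conjugate_multiplicity \<sigma> H V t \<noteq> 0" for t
    by (rule conjugate_time_iff[OF darboux H V])
  have bound: "enat N \<le> num_conjugate_times \<sigma> H V {0<..T}"
    if "N \<ge> 1" and T: "T \<ge> (real N + 3 * ?n - 1) * pi / ?s" for N T
  proof (cases "finite {t \<in> {0<..T}. conjugate_time \<sigma> H V t}")
    \<comment> \<open>Infinitely many conjugate times exceed every \<open>N\<close>; the crossing
      estimate is reserved for the finite case.\<close>
    case False
    then show ?thesis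
      by (rule num_conjugate_times_infinite) (simp add: conj)
  next
    case True
    let ?d = "conjugate_multiplicity \<sigma> H V"
    have eq: "{t. t \<in> {0<..T} \<and> conjugate_time \<sigma> H V t} = {t. t \<in> {0<..T} \<and> ?d t \<noteq> 0}"
      by (auto simp: conj)
    have "0 \<le> (real N + 3 * ?n - 1) * pi / ?s"
      using pos \<open>N \<ge> 1\<close> by simp
    with T have "0 \<le> T" by linarith
    have "T * ?s / pi - ?n < (\<Sum>t | t \<in> {0<..T} \<and> ?d t \<noteq> 0. real (?d t))"
    proof (rule symmetric_unitary_path_crossings)
      show "dim (fixed_space (souriau U w t)) \<le> ?d t" for t
        using range by (intro dim_fixed_space_le[OF darboux H U]) auto
    qed (use U \<open>0 \<le> T\<close> True eq in \<open>simp_all add: symmetric_unitary_souriau isCont_souriau souriau_0 det_souriau\<close>)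
    moreover have "real N + 3 * ?n - 1 \<le> T * ?s / pi"
      using T pos by (simp add: field_simps)
    moreover have "?n \<ge> 0"
      by simp
    \<comment> \<open>The count exceeds \<open>T * ?s / pi - ?n\<close>, which is at least
      \<open>N + 2 * ?n - 1\<close> and so at least \<open>N - 1\<close>; an integer above
      \<open>N - 1\<close> is at least \<open>N\<close>.\<close>
    ultimately have "real N - 1 < real (\<Sum>t | t \<in> {0<..T} \<and> ?d t \<noteq> 0. ?d t)"
      unfolding of_nat_sum by linarith
    then have "N \<le> (\<Sum>t | t \<in> {0<..T} \<and> ?d t \<noteq> 0. ?d t)"
      by linarith
    then show ?thesis
      using num_conjugate_times_finite[OF True] unfolding eq by (meson enat_ord_simps(1) order_trans)
  qed
  \<comment> \<open>This is the threshold for \<open>N = 1\<close>.\<close>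
  let ?T = "3 * ?n * pi / ?s"
  have "enat 1 \<le> num_conjugate_times \<sigma> H V {0<..?T}"
    by (rule bound) simp_all
  then obtain t where "t \<in> {0<..?T}" "conjugate_time \<sigma> H V t"
    using ex_conjugate_time by blast
  then have "first_conjugate_time \<sigma> H V \<le> ereal t" "ereal t \<le> ereal ?T"
    unfolding first_conjugate_time_def by (auto intro!: Inf_lower simp: conjugate_time_def)
  then have "first_conjugate_time \<sigma> H V \<le> ereal ?T"
    by (rule order_trans)
  with bound show ?thesis
    by blast
qed

end
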